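(* Let $\mathcal{G}$ be a locally compact, Hausdorff, étale groupoid with finite dynamic asymptotic dimension. Then $\mathcal{G}$ is amenable.
   Context: Precompact means having compact closure. Let $s,r$ denote source and range and $\mathcal{G}^{(0)}$ the unit space (not assumed compact). Dynamic asymptotic dimension: $\mathcal{G}$ has dynamic asymptotic dimension $d\in\mathbb{N}$ if $d$ is the smallest number such that for every open precompact subset $K\subseteq\mathcal{G}$ there are open subsets $U_0,\dots,U_d$ of $\mathcal{G}^{(0)}$ covering $s(K)\cup r(K)$ such that for each $i$ the set $\{g\in K\mid s(g),r(g)\in U_i\}$ is contained in a precompact subgroupoid of $\mathcal{G}$. It is finite if such a $d$ exists. Amenability: with $\mathcal{G}_x=s^{-1}(x)$, a locally compact Hausdorff étale groupoid $\mathcal{G}$ is amenable if for all compact $K\subseteq\mathcal{G}$ and all $\varepsilon>0$ there is a continuous, compactly supported $\mu:\mathcal{G}\to[0,1]$ such that (1) $\sum_{g\in\mathcal{G}_x}\mu(g)\le1$ for all $x\in\mathcal{G}^{(0)}$; (2) $|1-\sum_{g\in\mathcal{G}_{r(k)}}\mu(g)|<\varepsilon$ for all $k\in K$; (3) $\sum_{g\in\mathcal{G}_{r(k)}}|\mu(g)-\mu(gk)|<\varepsilon$ for all $k\in K$. *)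

theory Defs
  imports "HOL-Analysis.Analysis"
begin

text \<open>
  The set of arrows of a groupoid is the carrier \<^term>\<open>topspace T\<close> of its topology \<^term>\<open>T\<close>,
  and units are identified with the identity arrows, so that source and range take values
  in arrows. All operations are only meaningful on arrows; the product \<open>g \<odot> h\<close> is only
  meaningful when the source of \<open>g\<close> equals the range of \<open>h\<close>.
\<close>

record 'g top_groupoid =
  arrow_top :: "'g topology"
  src :: "'g \<Rightarrow> 'g" (\<open>\<s>\<index>\<close>)
  rng :: "'g \<Rightarrow> 'g" (\<open>\<r>\<index>\<close>)
  gmult :: "'g \<Rightarrow> 'g \<Rightarrow> 'g" (infixl \<open>\<odot>\<index>\<close> 70)
  ginv :: "'g \<Rightarrow> 'g"

definition arrows :: "'g top_groupoid \<Rightarrow> 'g set" where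
  "arrows G = topspace (arrow_top G)"

definition units :: "'g top_groupoid \<Rightarrow> 'g set" where
  "units G = src G ` arrows G"

definition unit_top :: "'g top_groupoid \<Rightarrow> 'g topology" where
  "unit_top G = subtopology (arrow_top G) (units G)"

definition composable :: "'g top_groupoid \<Rightarrow> ('g \<times> 'g) set" where
  "composable G = {(g, h). g \<in> arrows G \<and> h \<in> arrows G \<and> src G g = rng G h}"

locale groupoid =
  fixes G :: "'g top_groupoid" (structure)
  assumes src_closed: "g \<in> arrows G \<Longrightarrow> \<s> g \<in> arrows G"
    and rng_closed: "g \<in> arrows G \<Longrightarrow> \<r> g \<in> arrows G"
    and src_src: "g \<in> arrows G \<Longrightarrow> \<s> (\<s> g) = \<s> g"
    and rng_src: "g \<in> arrows G \<Longrightarrow> \<r> (\<s> g) = \<s> g"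
    and src_rng: "g \<in> arrows G \<Longrightarrow> \<s> (\<r> g) = \<r> g"
    and rng_rng: "g \<in> arrows G \<Longrightarrow> \<r> (\<r> g) = \<r> g"
    and mult_closed: "(g, h) \<in> composable G \<Longrightarrow> g \<odot> h \<in> arrows G"
    and src_mult: "(g, h) \<in> composable G \<Longrightarrow> \<s> (g \<odot> h) = \<s> h"
    and rng_mult: "(g, h) \<in> composable G \<Longrightarrow> \<r> (g \<odot> h) = \<r> g"
    and mult_assoc: "(g, h) \<in> composable G \<Longrightarrow> (h, k) \<in> composable G \<Longrightarrow>
                       (g \<odot> h) \<odot> k = g \<odot> (h \<odot> k)"
    and mult_src: "g \<in> arrows G \<Longrightarrow> g \<odot> \<s> g = g"
    and rng_mult_left: "g \<in> arrows G \<Longrightarrow> \<r> g \<odot> g = g"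
    and inv_closed: "g \<in> arrows G \<Longrightarrow> ginv G g \<in> arrows G"
    and src_inv: "g \<in> arrows G \<Longrightarrow> \<s> (ginv G g) = \<r> g"
    and rng_inv: "g \<in> arrows G \<Longrightarrow> \<r> (ginv G g) = \<s> g"
    and inv_mult: "g \<in> arrows G \<Longrightarrow> ginv G g \<odot> g = \<s> g"
    and mult_inv: "g \<in> arrows G \<Longrightarrow> g \<odot> ginv G g = \<r> g"

text \<open>
  Continuity of source and range is not listed, since it follows from continuity
  of the product and the inverse.
\<close>

locale topological_groupoid = groupoid +
  assumes continuous_mult:
      "continuous_map
         (subtopology (prod_topology (arrow_top G) (arrow_top G)) (composable G))
         (arrow_top G) (\<lambda>(g, h). g \<odot> h)"
    and continuous_inv: "continuous_map (arrow_top G) (arrow_top G) (ginv G)"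

definition local_homeomorphism :: "'a topology \<Rightarrow> 'b topology \<Rightarrow> ('a \<Rightarrow> 'b) \<Rightarrow> bool" where
  "local_homeomorphism X Y f \<longleftrightarrow>
     (\<forall>x \<in> topspace X. \<exists>U. openin X U \<and> x \<in> U \<and> openin Y (f ` U) \<and>
        homeomorphic_map (subtopology X U) (subtopology Y (f ` U)) f)"

locale etale_groupoid = topological_groupoid +
  assumes local_homeo_src: "local_homeomorphism (arrow_top G) (unit_top G) (src G)"
    and local_homeo_rng: "local_homeomorphism (arrow_top G) (unit_top G) (rng G)"

definition precompactin :: "'a topology \<Rightarrow> 'a set \<Rightarrow> bool" where
  "precompactin X S \<longleftrightarrow> S \<subseteq> topspace X \<and> compactin X (X closure_of S)"

text \<open>Closure under source and range follows from the two closure conditions.\<close>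

definition subgroupoid :: "'g top_groupoid \<Rightarrow> 'g set \<Rightarrow> bool" where
  "subgroupoid G H \<longleftrightarrow> H \<subseteq> arrows G \<and> (\<forall>g \<in> H. ginv G g \<in> H) \<and>
     (\<forall>g \<in> H. \<forall>h \<in> H. src G g = rng G h \<longrightarrow> gmult G g h \<in> H)"

definition dad_cover_property :: "'g top_groupoid \<Rightarrow> nat \<Rightarrow> bool" where
  "dad_cover_property G d \<longleftrightarrow>
     (\<forall>K. openin (arrow_top G) K \<and> precompactin (arrow_top G) K \<longrightarrow>
       (\<exists>U :: nat \<Rightarrow> 'g set.
          (\<forall>i \<le> d. openin (unit_top G) (U i)) \<and>
          src G ` K \<union> rng G ` K \<subseteq> (\<Union>i \<le> d. U i) \<and>
          (\<forall>i \<le> d. \<exists>H. subgroupoid G H \<and> precompactin (arrow_top G) H \<and>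
             {g \<in> K. src G g \<in> U i \<and> rng G g \<in> U i} \<subseteq> H)))"

definition has_dynamic_asymptotic_dimension :: "'g top_groupoid \<Rightarrow> nat \<Rightarrow> bool" where
  "has_dynamic_asymptotic_dimension G d \<longleftrightarrow>
     dad_cover_property G d \<and> (\<forall>e < d. \<not> dad_cover_property G e)"

definition finite_dynamic_asymptotic_dimension :: "'g top_groupoid \<Rightarrow> bool" where
  "finite_dynamic_asymptotic_dimension G \<longleftrightarrow> (\<exists>d. has_dynamic_asymptotic_dimension G d)"

definition source_fibre :: "'g top_groupoid \<Rightarrow> 'g \<Rightarrow> 'g set" where
  "source_fibre G x = {g \<in> arrows G. src G g = x}"

text \<open>
  In an etale Hausdorff groupoid a compact set meets each source fibre in a finite set, so
  the unordered sums below have only finitely many nonzero terms and the convention that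
  \<^const>\<open>infsum\<close> is zero on non-summable families never applies.
\<close>

definition amenable :: "'g top_groupoid \<Rightarrow> bool" where
  "amenable G \<longleftrightarrow>
     (\<forall>K. \<forall>\<epsilon>::real. compactin (arrow_top G) K \<and> \<epsilon> > 0 \<longrightarrow>
       (\<exists>\<mu> :: 'g \<Rightarrow> real.
          continuous_map (arrow_top G) (top_of_set {0..1}) \<mu> \<and>
          compactin (arrow_top G) (arrow_top G closure_of {g \<in> arrows G. \<mu> g \<noteq> 0}) \<and>
          (\<forall>x \<in> units G. (\<Sum>\<^sub>\<infinity>g \<in> source_fibre G x. \<mu> g) \<le> 1) \<and>
          (\<forall>k \<in> K. \<bar>1 - (\<Sum>\<^sub>\<infinity>g \<in> source_fibre G (rng G k). \<mu> g)\<bar> < \<epsilon>) \<and>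
          (\<forall>k \<in> K. (\<Sum>\<^sub>\<infinity>g \<in> source_fibre G (rng G k). \<bar>\<mu> g - \<mu> (gmult G g k)\<bar>) < \<epsilon>)))"

end

theory Submission
  imports Defs
begin

text \<open>
  Fix a compact set \<open>K\<close> and cover the units in question by the open sets \<open>U\<^sub>0, \<dots>, U\<^sub>d\<close> that dynamic
  asymptotic dimension \<open>d\<close> provides for the arrows of \<open>K\<close>-length at most \<open>2 N + 1\<close>. Thickening each \<open>U\<^sub>i\<close>
  along at most \<open>N\<close> arrows gives functions \<open>\<Psi>\<^sub>i\<close> on the units that vary by at most \<open>1 / N\<close> along \<open>K\<close>, and
  the arrows of \<open>K\<close> between points of the support of \<open>\<Psi>\<^sub>i\<close> still generate a precompact subgroupoid, since
  they are conjugate to arrows of \<open>H\<^sub>i\<close> by paths into \<open>U\<^sub>i\<close>. On this subgroupoid one would use the uniform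
  probability measures of its source fibres, weighted by the normalised \<open>\<Psi>\<^sub>i\<close>. As they need not depend
  continuously on the base point, they are replaced by averages of the iterates of a continuous
  propagation operator; the same operator produces the \<open>\<Psi>\<^sub>i\<close>. It preserves continuity because the source map is a
  local homeomorphism, so that a sum over a source fibre is locally a finite sum over local sections.
\<close>

section \<open>Bump functions subordinate to a finite open cover\<close>

text \<open>Complete regularity gives one function per point of \<open>K\<close>; compactness leaves
  finitely many, and those with the same index are summed. Cutting the sum off at 1/2 makes room for
  the closed set \<open>Z i\<close> between the support and \<open>U i\<close>, which later yields
  compact supports inside sections.\<close>

lemma compact_cover_bumps:
  assumes cr: "completely_regular_space X" and K: "compactin X K"
    and I: "finite I" and U: "\<And>i. i \<in> I \<Longrightarrow> openin X (U i)" and KU: "K \<subseteq> (\<Union>i\<in>I. U i)"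
  obtains \<rho> :: "'i \<Rightarrow> 'a \<Rightarrow> real" and Z where
    "\<And>i. i \<in> I \<Longrightarrow> continuous_map X euclideanreal (\<rho> i)"
    "\<And>i x. 0 \<le> \<rho> i x" "\<And>i x. \<rho> i x \<le> 1"
    "\<And>i. i \<in> I \<Longrightarrow> closedin X (Z i)" "\<And>i. i \<in> I \<Longrightarrow> Z i \<subseteq> U i"
    "\<And>i x. i \<in> I \<Longrightarrow> \<rho> i x \<noteq> 0 \<Longrightarrow> x \<in> Z i"
    "\<And>x. x \<in> K \<Longrightarrow> \<exists>i\<in>I. \<rho> i x = 1"
proof -
  have KX: "K \<subseteq> topspace X"
    using K compactin_subset_topspace by blast
  have "\<exists>i f. i \<in> I \<and> continuous_map X euclideanreal f \<and> f x = (1::real) \<and> f ` (topspace X - U i) \<subseteq> {0}"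
    if "x \<in> K" for x
  proof -
    obtain i where "i \<in> I" "x \<in> U i" using KU \<open>x \<in> K\<close> by auto
    then show ?thesis
      using cr U[of i] completely_regular_space_gen_alt'[of 1 0 X] by (metis zero_neq_one)
  qed
  then obtain i f where i: "\<And>x. x \<in> K \<Longrightarrow> i x \<in> I"
    and f: "\<And>x. x \<in> K \<Longrightarrow> continuous_map X euclideanreal (f x)"
    and f1: "\<And>x. x \<in> K \<Longrightarrow> f x x = (1::real)"
    and f0: "\<And>x. x \<in> K \<Longrightarrow> f x ` (topspace X - U (i x)) \<subseteq> {0}"
    by metis
  define V where "V x = {y \<in> topspace X. f x y \<in> {3/4<..}}" for x
  have V: "openin X (V x)" if "x \<in> K" for x
    unfolding V_def by (rule openin_continuous_map_preimage[OF f[OF that]]) (simp add: open_greaterThan)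
  have xV: "x \<in> V x" if "x \<in> K" for x
    using that KX f1 by (auto simp: V_def)
  have "\<exists>F. finite F \<and> F \<subseteq> V ` K \<and> K \<subseteq> \<Union>F"
    using K V xV unfolding compactin_def by (metis (no_types, lifting) UN_I imageE subsetI)
  then obtain F where F: "finite F" "F \<subseteq> K" "K \<subseteq> \<Union>(V ` F)"
    by (metis finite_subset_image)
  define \<sigma> where "\<sigma> j y = (\<Sum>x\<in>{x\<in>F. i x = j}. max 0 (f x y))" for j y
  have c\<sigma>: "continuous_map X euclideanreal (\<sigma> j)" for j
    unfolding \<sigma>_def using F(1,2) f by (intro continuous_intros) auto
  define Z where "Z j = {y \<in> topspace X. \<sigma> j y \<in> {1/2..}}" for j
  \<comment> \<open>This ramp is 0 up to the level 1/2 and 1 from 3/4 on, the level that defines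
    \<open>V\<close>. The value 0 off the space makes the support claim hold for every
    \<open>y\<close>.\<close>
  define \<rho> where "\<rho> j y = (if y \<in> topspace X then min 1 (max 0 (4 * \<sigma> j y - 2)) else 0)" for j y
  show thesis
  proof (rule that)
    show "continuous_map X euclideanreal (\<rho> j)" for j
    proof (rule continuous_map_eq)
      show "continuous_map X euclideanreal (\<lambda>y. min 1 (max 0 (4 * \<sigma> j y - 2)))"
        using c\<sigma>[of j] by (intro continuous_intros) auto
    qed (simp add: \<rho>_def)
    show "0 \<le> \<rho> j y" "\<rho> j y \<le> 1" for j y by (auto simp: \<rho>_def)
    show "closedin X (Z j)" for j
      unfolding Z_def by (rule closedin_continuous_map_preimage[OF c\<sigma>]) simp
    show "Z j \<subseteq> U j" for j
    proof
      fix y assume y: "y \<in> Z j"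
      then have "\<sigma> j y \<noteq> 0" by (auto simp: Z_def)
      then obtain x where "x \<in> F" "i x = j" "f x y \<noteq> 0"
        unfolding \<sigma>_def by (metis (mono_tags, lifting) max.idem mem_Collect_eq sum.neutral)
      then show "y \<in> U j" using f0[of x] F(2) y by (auto simp: Z_def)
    qed
    show "y \<in> Z j" if "\<rho> j y \<noteq> 0" for j y
      using that by (auto simp: \<rho>_def Z_def split: if_splits)
    show "\<exists>j\<in>I. \<rho> j y = 1" if y: "y \<in> K" for y
    proof -
      obtain x where x: "x \<in> F" "y \<in> V x" using F y by auto
      have "max 0 (f x y) \<le> \<sigma> (i x) y"
        unfolding \<sigma>_def using F(1) x by (intro member_le_sum) auto
      then have "\<rho> (i x) y = 1" using x by (auto simp: V_def \<rho>_def)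
      then show ?thesis using i x F(2) by blast
    qed
  qed
qed

section \<open>Algebra, compactness and source fibres\<close>

locale lch_etale_groupoid = etale_groupoid +
  assumes locally_compact: "locally_compact_space (arrow_top G)"
    and Hausdorff: "Hausdorff_space (arrow_top G)"
begin

abbreviation "\<T> \<equiv> arrow_top G"
abbreviation inv_arrow (\<open>(_\<^sup>\<star>)\<close> [1000] 999) where "g\<^sup>\<star> \<equiv> ginv G g"

lemmas [simp] = src_closed rng_closed src_src rng_src src_rng rng_rng mult_src rng_mult_left
  inv_closed src_inv rng_inv inv_mult mult_inv

lemma topspace_arrows [simp]: "topspace \<T> = arrows G"
  by (simp add: arrows_def)

lemma composable_iff [simp]: "(g, h) \<in> composable G \<longleftrightarrow> g \<in> arrows G \<and> h \<in> arrows G \<and> \<s> g = \<r> h"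
  by (simp add: composable_def)

lemma mult_arrow [simp]:
  assumes "g \<in> arrows G" "h \<in> arrows G" "\<s> g = \<r> h"
  shows "g \<odot> h \<in> arrows G" "\<s> (g \<odot> h) = \<s> h" "\<r> (g \<odot> h) = \<r> g"
  using mult_closed src_mult rng_mult assms by auto

lemma assoc:
  "g \<in> arrows G \<Longrightarrow> h \<in> arrows G \<Longrightarrow> k \<in> arrows G \<Longrightarrow> \<s> g = \<r> h \<Longrightarrow> \<s> h = \<r> k \<Longrightarrow>
    (g \<odot> h) \<odot> k = g \<odot> (h \<odot> k)"
  using mult_assoc by auto

lemma mult_inv_cancel [simp]: "g \<in> arrows G \<Longrightarrow> k \<in> arrows G \<Longrightarrow> \<s> g = \<r> k \<Longrightarrow> g \<odot> k \<odot> k\<^sup>\<star> = g"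
  by (simp add: assoc) (metis mult_src)

lemma inv_mult_cancel [simp]: "g \<in> arrows G \<Longrightarrow> k \<in> arrows G \<Longrightarrow> \<s> g = \<s> k \<Longrightarrow> g \<odot> k\<^sup>\<star> \<odot> k = g"
  by (simp add: assoc) (metis mult_src)

lemma inv_mult_cancel_left [simp]: "g \<in> arrows G \<Longrightarrow> k \<in> arrows G \<Longrightarrow> \<r> g = \<s> k \<Longrightarrow> k\<^sup>\<star> \<odot> (k \<odot> g) = g"
  by (simp add: assoc[symmetric]) (metis rng_mult_left)

lemma bij_betw_mult_right:
  assumes "k \<in> arrows G"
  shows "bij_betw (\<lambda>g. g \<odot> k) (source_fibre G (\<r> k)) (source_fibre G (\<s> k))"
  by (rule bij_betwI[where g = "\<lambda>g. g \<odot> k\<^sup>\<star>"]) (use assms in \<open>auto simp: source_fibre_def\<close>)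

lemma units_subset: "units G \<subseteq> arrows G"
  by (auto simp: units_def)

lemma topspace_unit_top [simp]: "topspace (unit_top G) = units G"
  using units_subset by (auto simp: unit_top_def)

lemma local_homeomorphism_continuous:
  assumes "local_homeomorphism X Y f" shows "continuous_map X Y f"
proof -
  obtain U where U: "\<And>x. x \<in> topspace X \<Longrightarrow> openin X (U x) \<and> x \<in> U x \<and>
      homeomorphic_map (subtopology X (U x)) (subtopology Y (f ` U x)) f"
    using assms unfolding local_homeomorphism_def by metis
  show ?thesis
  proof (rule pasting_lemma[where I = "topspace X" and T = U and f = "\<lambda>_. f"])
    show "continuous_map (subtopology X (U x)) Y f" if "x \<in> topspace X" for x
      using U[OF that] homeomorphic_imp_continuous_map continuous_map_in_subtopology by blast
  qed (use U in auto)
qed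

lemma continuous_src_units: "continuous_map \<T> (unit_top G) \<s>"
  and continuous_rng_units: "continuous_map \<T> (unit_top G) \<r>"
  using local_homeo_src local_homeo_rng by (auto intro: local_homeomorphism_continuous)

lemma continuous_src: "continuous_map \<T> \<T> \<s>" and continuous_rng: "continuous_map \<T> \<T> \<r>"
  using continuous_src_units continuous_rng_units
  by (auto simp: unit_top_def continuous_map_in_subtopology)

lemma completely_regular: "completely_regular_space \<T>"
  using Hausdorff locally_compact locally_compact_regular_imp_completely_regular_space by blast

lemma compact_closed: "compactin \<T> C \<Longrightarrow> closedin \<T> C"
  using Hausdorff compactin_imp_closedin by blast

lemma compact_arrows: "compactin \<T> C \<Longrightarrow> C \<subseteq> arrows G"
  using compactin_subset_topspace by fastforce

definition set_mult :: "'a set \<Rightarrow> 'a set \<Rightarrow> 'a set" (infixl \<open>\<otimes>\<close> 70) where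
  "A \<otimes> B = {g \<odot> h | g h. g \<in> A \<and> h \<in> B \<and> \<s> g = \<r> h}"

text \<open>Since the arrows form a Hausdorff space, composability is the coincidence of two
  continuous maps and hence closed. So the composable part of \<open>A \<times> B\<close> is
  compact, and the product is continuous on it.\<close>

lemma compact_set_mult:
  assumes "compactin \<T> A" "compactin \<T> B" shows "compactin \<T> (A \<otimes> B)"
proof -
  let ?P = "prod_topology \<T> \<T>"
  have "closedin ?P {p \<in> topspace ?P. (\<s> \<circ> fst) p = (\<r> \<circ> snd) p}"
    using Hausdorff continuous_src continuous_rng
    by (intro closedin_continuous_maps_eq[of \<T>] continuous_map_compose[of _ \<T>])
       (auto intro: continuous_map_fst continuous_map_snd)
  then have "compactin ?P ({p \<in> topspace ?P. (\<s> \<circ> fst) p = (\<r> \<circ> snd) p} \<inter> (A \<times> B))"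
    using assms by (intro closed_Int_compactin) (auto simp: compactin_Times)
  moreover have "{p \<in> topspace ?P. (\<s> \<circ> fst) p = (\<r> \<circ> snd) p} \<inter> (A \<times> B) = composable G \<inter> (A \<times> B)"
    by (auto simp: composable_def)
  ultimately have "compactin (subtopology ?P (composable G)) (composable G \<inter> (A \<times> B))"
    by (simp add: compactin_subtopology)
  from image_compactin[OF this continuous_mult] have "compactin \<T> ((\<lambda>(g, h). g \<odot> h) ` (composable G \<inter> (A \<times> B)))" .
  moreover have "(\<lambda>(g, h). g \<odot> h) ` (composable G \<inter> (A \<times> B)) = A \<otimes> B"
    using assms[THEN compact_arrows] by (auto simp: set_mult_def image_iff composable_def)
  ultimately show ?thesis by simp
qed

lemma compact_inv: "compactin \<T> A \<Longrightarrow> compactin \<T> (ginv G ` A)"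
  using continuous_inv image_compactin by blast

text \<open>Each set of the cover carries a continuous local section of the source map. In this form
  the etale hypothesis enters both the fibre bound and the continuity of fibre sums.\<close>

lemma etale_cover:
  assumes "compactin \<T> C"
  obtains \<U> where "finite \<U>" "C \<subseteq> \<Union>\<U>"
    "\<And>U. U \<in> \<U> \<Longrightarrow> openin \<T> U \<and> openin (unit_top G) (\<s> ` U) \<and>
       homeomorphic_map (subtopology \<T> U) (subtopology (unit_top G) (\<s> ` U)) \<s>"
proof -
  let ?P = "\<lambda>U. openin \<T> U \<and> openin (unit_top G) (\<s> ` U) \<and>
       homeomorphic_map (subtopology \<T> U) (subtopology (unit_top G) (\<s> ` U)) \<s>"
  have "\<exists>U. ?P U \<and> x \<in> U" if "x \<in> C" for x
    using local_homeo_src compact_arrows[OF assms] that unfolding local_homeomorphism_def topspace_arrows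
    by (meson subsetD)
  then have "C \<subseteq> \<Union>(Collect ?P)" by blast
  moreover have "\<And>U. U \<in> Collect ?P \<Longrightarrow> openin \<T> U" by blast
  ultimately obtain \<U> where \<U>: "finite \<U>" "\<U> \<subseteq> Collect ?P" "C \<subseteq> \<Union>\<U>"
    using assms unfolding compactin_def by meson
  show thesis by (rule that[of \<U>]) (use \<U> in blast)+
qed

lemma homeomorphic_src_inj:
  assumes "openin \<T> U" "homeomorphic_map (subtopology \<T> U) (subtopology (unit_top G) (\<s> ` U)) \<s>"
  shows "inj_on \<s> U"
  using assms homeomorphic_imp_injective_map openin_subset by (fastforce simp: inf_absorb2)

text \<open>The source map is injective on each of finitely many sets covering \<open>C\<close>, so
  distinct points of a fibre need distinct sets. The bound is the size of the cover, uniform in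
  \<open>x\<close>.\<close>

lemma fibre_card_bounded:
  assumes "compactin \<T> C"
  obtains M where "\<And>x. finite (C \<inter> source_fibre G x)" "\<And>x. card (C \<inter> source_fibre G x) \<le> M"
proof -
  obtain \<U> where \<U>: "finite \<U>" "C \<subseteq> \<Union>\<U>" "\<And>U. U \<in> \<U> \<Longrightarrow> inj_on \<s> U"
    using etale_cover[OF assms] homeomorphic_src_inj by metis
  have *: "finite (C \<inter> source_fibre G x) \<and> card (C \<inter> source_fibre G x) \<le> card \<U>" for x
  proof -
    have "\<exists>u. u \<in> \<U> \<and> g \<in> u" if "g \<in> C" for g using \<U>(2) that by auto
    then obtain u where u: "\<And>g. g \<in> C \<Longrightarrow> u g \<in> \<U> \<and> g \<in> u g" by metis
    have "inj_on u (C \<inter> source_fibre G x)"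
    proof (rule inj_onI)
      fix g h assume gh: "g \<in> C \<inter> source_fibre G x" "h \<in> C \<inter> source_fibre G x" "u g = u h"
      have "inj_on \<s> (u g)" "g \<in> u g" "h \<in> u g" "\<s> g = \<s> h"
        using u[of g] u[of h] gh \<U>(3) by (auto simp: source_fibre_def)
      then show "g = h" by (meson inj_onD)
    qed
    moreover have "u ` (C \<inter> source_fibre G x) \<subseteq> \<U>" using u by (simp add: image_subset_iff)
    ultimately show ?thesis
      using card_inj_on_le[OF _ _ \<U>(1)] inj_on_finite[OF _ _ \<U>(1)] by (intro conjI)
  qed
  then show thesis using that by blast
qed

end

section \<open>Continuity of sums over source fibres\<close>

context lch_etale_groupoid
begin

text \<open>The pairs for which \<open>g \<odot> k\<^sup>\<star>\<close> makes sense.\<close>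

definition cosource :: "('a \<times> 'a) set" where
  "cosource = {(g, k). g \<in> arrows G \<and> k \<in> arrows G \<and> \<s> g = \<s> k}"

abbreviation "cosource_top \<equiv> subtopology (prod_topology \<T> \<T>) cosource"

text \<open>As \<open>b\<close> lives inside one section, at most one term is nonzero, at
  \<open>k = \<tau> (\<s> g)\<close> with \<open>\<tau>\<close> inverse to the source map on
  \<open>U\<close>. This expression is continuous on \<open>V\<close>, the arrows with source in the
  image of \<open>U\<close>; on \<open>W\<close>, where the source avoids the compact image of
  \<open>Z\<close>, the sum is 0. The open sets \<open>V\<close> and \<open>W\<close> cover all
  arrows because \<open>Z\<close> lies in \<open>U\<close>.\<close>

lemma continuous_fibre_sum_section:
  assumes U: "openin \<T> U" "openin (unit_top G) (\<s> ` U)"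
      "homeomorphic_map (subtopology \<T> U) (subtopology (unit_top G) (\<s> ` U)) \<s>"
    and C: "compactin \<T> C"
    and b: "continuous_map \<T> euclideanreal b"
    and Z: "compactin \<T> Z" "Z \<subseteq> U" "Z \<subseteq> C" "\<And>k. b k \<noteq> 0 \<Longrightarrow> k \<in> Z"
    and v: "continuous_map cosource_top euclideanreal (\<lambda>(g, k). v g k)"
  shows "continuous_map \<T> euclideanreal (\<lambda>g. \<Sum>k\<in>C \<inter> source_fibre G (\<s> g). b k * v g k)"
proof -
  obtain \<tau> where \<tau>: "homeomorphic_maps (subtopology \<T> U) (subtopology (unit_top G) (\<s> ` U)) \<s> \<tau>"
    using U(3) homeomorphic_map_maps by blast
  have UA: "U \<subseteq> arrows G" using U(1) openin_subset by fastforce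
  have sU: "\<s> ` U \<subseteq> units G" using UA by (auto simp: units_def)
  have \<tau>c: "continuous_map (subtopology (unit_top G) (\<s> ` U)) (subtopology \<T> U) \<tau>"
    and \<tau>s: "\<And>k. k \<in> U \<Longrightarrow> \<tau> (\<s> k) = k"
    using \<tau> UA by (auto simp: homeomorphic_maps_def inf_absorb2)
  define V where "V = {g \<in> topspace \<T>. \<s> g \<in> \<s> ` U}"
  define W where "W = {g \<in> topspace \<T>. \<s> g \<in> units G - \<s> ` Z}"
  have "Hausdorff_space (unit_top G)"
    unfolding unit_top_def by (simp add: Hausdorff Hausdorff_space_subtopology)
  then have "closedin (unit_top G) (\<s> ` Z)"
    using Z(1) continuous_src_units compactin_imp_closedin image_compactin by metis
  then have W: "openin \<T> W"
    unfolding W_def using continuous_src_units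
    by (metis openin_continuous_map_preimage openin_diff openin_topspace topspace_unit_top)
  have V: "openin \<T> V"
    unfolding V_def using continuous_src_units U(2) by (rule openin_continuous_map_preimage)
  have VA: "V \<subseteq> arrows G" by (auto simp: V_def)
  have \<tau>V: "\<tau> (\<s> g) \<in> U" "\<s> (\<tau> (\<s> g)) = \<s> g" if "g \<in> V" for g
    using that \<tau>s by (auto simp: V_def)
  have \<sigma>: "continuous_map (subtopology \<T> V) \<T> (\<lambda>g. \<tau> (\<s> g))"
  proof -
    have "continuous_map (subtopology \<T> V) (subtopology (unit_top G) (\<s> ` U)) \<s>"
      using continuous_src_units by (auto simp: continuous_map_in_subtopology V_def continuous_map_from_subtopology)
    from continuous_map_compose[OF this \<tau>c] show ?thesis
      by (simp add: continuous_map_in_subtopology o_def)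
  qed
  have "continuous_map (subtopology \<T> V) cosource_top (\<lambda>g. (g, \<tau> (\<s> g)))"
    unfolding continuous_map_in_subtopology continuous_map_pairwise
    using \<sigma> VA \<tau>V UA by (auto simp: cosource_def o_def)
  from continuous_map_compose[OF this v]
  have "continuous_map (subtopology \<T> V) euclideanreal (\<lambda>g. v g (\<tau> (\<s> g)))"
    by (simp add: o_def)
  moreover have "continuous_map (subtopology \<T> V) euclideanreal (\<lambda>g. b (\<tau> (\<s> g)))"
    using continuous_map_compose[OF \<sigma> b] by (simp add: o_def)
  ultimately have cV: "continuous_map (subtopology \<T> V) euclideanreal (\<lambda>g. b (\<tau> (\<s> g)) * v g (\<tau> (\<s> g)))"
    by (rule continuous_map_real_mult[rotated])
  have fin: "finite (C \<inter> source_fibre G x)" for x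
    using fibre_card_bounded[OF C] by metis
  have eV: "(\<Sum>k\<in>C \<inter> source_fibre G (\<s> g). b k * v g k) = b (\<tau> (\<s> g)) * v g (\<tau> (\<s> g))" if g: "g \<in> V" for g
  proof (cases "\<tau> (\<s> g) \<in> C")
    case True
    have "(\<Sum>k\<in>C \<inter> source_fibre G (\<s> g). b k * v g k) = (\<Sum>k\<in>{\<tau> (\<s> g)}. b k * v g k)"
    proof (rule sum.mono_neutral_right[OF fin])
      show "{\<tau> (\<s> g)} \<subseteq> C \<inter> source_fibre G (\<s> g)"
        using True \<tau>V[OF g] UA by (auto simp: source_fibre_def)
      show "\<forall>k\<in>C \<inter> source_fibre G (\<s> g) - {\<tau> (\<s> g)}. b k * v g k = 0"
      proof (intro ballI, rule ccontr)
        fix k assume k: "k \<in> C \<inter> source_fibre G (\<s> g) - {\<tau> (\<s> g)}" "b k * v g k \<noteq> 0"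
        then have "k \<in> U" "\<s> k = \<s> g" using Z by (auto simp: source_fibre_def)
        then show False using \<tau>s[of k] k by auto
      qed
    qed
    then show ?thesis by simp
  next
    case False
    then have "b (\<tau> (\<s> g)) = 0" using Z by blast
    moreover have "b k = 0" if "k \<in> C \<inter> source_fibre G (\<s> g)" for k
    proof (rule ccontr)
      assume "b k \<noteq> 0"
      then have "k \<in> U" "\<s> k = \<s> g" using Z that by (auto simp: source_fibre_def)
      then show False using \<tau>s[of k] False that by auto
    qed
    ultimately show ?thesis by simp
  qed
  have eW: "(\<Sum>k\<in>C \<inter> source_fibre G (\<s> g). b k * v g k) = 0" if g: "g \<in> W" for g
  proof (intro sum.neutral ballI)
    fix k assume "k \<in> C \<inter> source_fibre G (\<s> g)"
    then have "\<s> k = \<s> g" by (simp add: source_fibre_def)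
    then have "k \<notin> Z" using g imageI[of k Z "\<s>"] by (auto simp: W_def)
    then show "b k * v g k = 0" using Z(4) by auto
  qed
  show ?thesis
  proof (rule pasting_lemma[where I = UNIV and T = "\<lambda>i. if i then V else W"
        and f = "\<lambda>i g. if i then b (\<tau> (\<s> g)) * v g (\<tau> (\<s> g)) else 0"], goal_cases)
    case (1 i)
    show ?case using V W by auto
  next
    case (2 i)
    show ?case using cV by (cases i) auto
  next
    case (3 i j g)
    then show ?case using eV[of g] eW[of g] by (auto split: if_splits)
  next
    case (4 g)
    show ?case
    proof (cases "\<s> g \<in> \<s> ` U")
      case True
      then have "g \<in> V" using 4 by (auto simp: V_def)
      then show ?thesis using eV by (intro exI[of _ True]) auto
    next
      case False
      then have "g \<in> W" using 4 Z(2) by (auto simp: W_def units_def)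
      then show ?thesis using eW by (intro exI[of _ False]) auto
    qed
  qed
qed

text \<open>A partition of unity splits \<open>a\<close> into pieces, each supported in a single
  section.\<close>

lemma continuous_fibre_sum:
  assumes C: "compactin \<T> C"
    and a: "continuous_map \<T> euclideanreal a" "\<And>k. a k \<noteq> 0 \<Longrightarrow> k \<in> C"
    and v: "continuous_map cosource_top euclideanreal (\<lambda>(g, k). v g k)"
  shows "continuous_map \<T> euclideanreal (\<lambda>g. \<Sum>k\<in>C \<inter> source_fibre G (\<s> g). a k * v g k)"
proof -
  obtain \<U> where \<U>: "finite \<U>" "C \<subseteq> \<Union>\<U>"
    "\<And>U. U \<in> \<U> \<Longrightarrow> openin \<T> U \<and> openin (unit_top G) (\<s> ` U) \<and>
       homeomorphic_map (subtopology \<T> U) (subtopology (unit_top G) (\<s> ` U)) \<s>"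
    using etale_cover[OF C] by metis
  have "C \<subseteq> (\<Union>U\<in>\<U>. U)" using \<U>(2) by simp
  then obtain \<rho> :: "'a set \<Rightarrow> 'a \<Rightarrow> real" and Z where
    \<rho>: "\<And>U. U \<in> \<U> \<Longrightarrow> continuous_map \<T> euclideanreal (\<rho> U)"
    "\<And>U x. 0 \<le> \<rho> U x" "\<And>U. U \<in> \<U> \<Longrightarrow> closedin \<T> (Z U)" "\<And>U. U \<in> \<U> \<Longrightarrow> Z U \<subseteq> U"
    "\<And>U x. U \<in> \<U> \<Longrightarrow> \<rho> U x \<noteq> 0 \<Longrightarrow> x \<in> Z U" "\<And>x. x \<in> C \<Longrightarrow> \<exists>U\<in>\<U>. \<rho> U x = 1"
    using compact_cover_bumps[OF completely_regular C \<U>(1), of "\<lambda>U. U"] \<U>(3) by metis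
  \<comment> \<open>The maximum with 1 keeps \<open>b U\<close> continuous everywhere. On
    \<open>C\<close> the bumps sum to at least 1, so the pieces add up to \<open>a\<close>; off
    \<open>C\<close> everything vanishes.\<close>
  define b where "b U k = a k * (\<rho> U k / max 1 (\<Sum>U\<in>\<U>. \<rho> U k))" for U k
  have ab: "a k = (\<Sum>U\<in>\<U>. b U k)" for k
  proof (cases "k \<in> C")
    case True
    then obtain U where "U \<in> \<U>" "\<rho> U k = 1" using \<rho>(6) by blast
    then have "(\<Sum>U\<in>\<U>. \<rho> U k) \<ge> 1" using \<rho>(2) \<U>(1) member_le_sum[of U \<U> "\<lambda>U. \<rho> U k"] by simp
    then show ?thesis by (simp add: b_def sum_distrib_left[symmetric] sum_divide_distrib[symmetric])
  next
    case False
    then have "a k = 0" using a(2) by blast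
    then show ?thesis by (simp add: b_def)
  qed
  have "continuous_map \<T> euclideanreal (\<lambda>g. \<Sum>k\<in>C \<inter> source_fibre G (\<s> g). b U k * v g k)"
    if U: "U \<in> \<U>" for U
  proof (rule continuous_fibre_sum_section)
    show "openin \<T> U" "openin (unit_top G) (\<s> ` U)"
      "homeomorphic_map (subtopology \<T> U) (subtopology (unit_top G) (\<s> ` U)) \<s>"
      using \<U>(3)[OF U] by auto
    show "continuous_map \<T> euclideanreal (b U)"
      unfolding b_def using a(1) \<rho>(1) U \<U>(1) by (intro continuous_intros) auto
    show "compactin \<T> (C \<inter> Z U)" using C \<rho>(3)[OF U] by (simp add: compact_Int_closedin)
    show "C \<inter> Z U \<subseteq> U" using \<rho>(4)[OF U] by auto
    show "k \<in> C \<inter> Z U" if "b U k \<noteq> 0" for k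
      using that a(2)[of k] \<rho>(5)[OF U, of k] by (auto simp: b_def)
  qed (use C v in auto)
  then have "continuous_map \<T> euclideanreal (\<lambda>g. \<Sum>U\<in>\<U>. \<Sum>k\<in>C \<inter> source_fibre G (\<s> g). b U k * v g k)"
    using \<U>(1) by (intro continuous_map_sum) auto
  also have "(\<lambda>g. \<Sum>U\<in>\<U>. \<Sum>k\<in>C \<inter> source_fibre G (\<s> g). b U k * v g k)
      = (\<lambda>g. \<Sum>k\<in>C \<inter> source_fibre G (\<s> g). a k * v g k)"
    by (subst sum.swap) (simp add: ab sum_distrib_right)
  finally show ?thesis .
qed

lemma continuous_right_translate:
  assumes "continuous_map \<T> euclideanreal u"
  shows "continuous_map cosource_top euclideanreal (\<lambda>(g, k). u (g \<odot> k\<^sup>\<star>))"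
proof -
  let ?P = "prod_topology \<T> \<T>"
  have "continuous_map cosource_top ?P (\<lambda>p. (fst p, (snd p)\<^sup>\<star>))"
    unfolding continuous_map_pairwise using continuous_inv
    by (auto simp: o_def intro!: continuous_map_from_subtopology continuous_map_compose[of _ \<T> snd _ "ginv G", unfolded o_def]
        continuous_map_fst continuous_map_snd)
  then have "continuous_map cosource_top (subtopology ?P (composable G)) (\<lambda>p. (fst p, (snd p)\<^sup>\<star>))"
    by (auto simp: continuous_map_in_subtopology cosource_def)
  from continuous_map_compose[OF continuous_map_compose[OF this continuous_mult] assms]
  show ?thesis by (simp add: o_def case_prod_unfold)
qed

text \<open>If \<open>a k = 1\<close>, then \<open>u g\<close> is one of the terms of \<open>step C a u (g \<odot> k)\<close>. Hence right translation by \<open>k\<close>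
  costs at most one iteration, and the averages of the iterates are almost invariant.\<close>

definition step :: "'a set \<Rightarrow> ('a \<Rightarrow> real) \<Rightarrow> ('a \<Rightarrow> real) \<Rightarrow> 'a \<Rightarrow> real" where
  "step C a u g = min 1 (\<Sum>k\<in>C \<inter> source_fibre G (\<s> g). a k * u (g \<odot> k\<^sup>\<star>))"

lemma step_nonzero:
  assumes "step C a u g \<noteq> 0"
  obtains k where "k \<in> C" "k \<in> source_fibre G (\<s> g)" "a k \<noteq> 0" "u (g \<odot> k\<^sup>\<star>) \<noteq> 0"
proof -
  have "(\<Sum>k\<in>C \<inter> source_fibre G (\<s> g). a k * u (g \<odot> k\<^sup>\<star>)) \<noteq> 0"
    using assms by (auto simp: step_def)
  then obtain k where "k \<in> C \<inter> source_fibre G (\<s> g)" "a k * u (g \<odot> k\<^sup>\<star>) \<noteq> 0"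
    using sum.not_neutral_contains_not_neutral by blast
  then show thesis using that by auto
qed

definition avg :: "'a set \<Rightarrow> nat \<Rightarrow> ('a \<Rightarrow> real) \<Rightarrow> ('a \<Rightarrow> real) \<Rightarrow> 'a \<Rightarrow> real" where
  "avg C N a u g = (\<Sum>n<N. (step C a ^^ n) u g) / real N"

end

section \<open>Averages of the iterated propagation\<close>

text \<open>Used twice: with \<open>a = f\<close> and \<open>u\<close> a bump composed with the
  source map, to thicken a set of units; and with \<open>a = u = \<eta>\<close>, to spread mass
  along source fibres.\<close>

locale weight = lch_etale_groupoid +
  fixes C :: "'a set" and a u :: "'a \<Rightarrow> real"
  assumes C: "compactin (arrow_top G) C"
    and a_nonneg: "\<And>k. 0 \<le> a k" and a_support: "\<And>k. a k \<noteq> 0 \<Longrightarrow> k \<in> C"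
    and a_cont: "continuous_map (arrow_top G) euclideanreal a"
    and u_nonneg: "\<And>g. 0 \<le> u g" and u_le_1: "\<And>g. u g \<le> 1"
    and u_cont: "continuous_map (arrow_top G) euclideanreal u"
begin

abbreviation "u\<^sub>n n \<equiv> (step C a ^^ n) u"

lemma iter_nonneg: "0 \<le> u\<^sub>n n g"
  by (induction n arbitrary: g) (auto simp: u_nonneg a_nonneg step_def intro!: sum_nonneg)

lemma iter_le_1: "u\<^sub>n n g \<le> 1"
  by (cases n) (auto simp: u_le_1 step_def)

lemma iter_continuous: "continuous_map \<T> euclideanreal (u\<^sub>n n)"
proof (induction n)
  case (Suc n)
  have "continuous_map \<T> euclideanreal
      (\<lambda>g. min 1 (\<Sum>k\<in>C \<inter> source_fibre G (\<s> g). a k * u\<^sub>n n (g \<odot> k\<^sup>\<star>)))"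
    by (intro continuous_intros continuous_fibre_sum[OF C a_cont] continuous_right_translate Suc)
       (use a_support in auto)
  then show ?case by (simp add: step_def[abs_def])
qed (simp add: u_cont)

lemma iter_shift:
  assumes "g \<in> arrows G" "k \<in> arrows G" "\<s> g = \<r> k" "a k = 1"
  shows "u\<^sub>n n g \<le> u\<^sub>n (Suc n) (g \<odot> k)"
proof -
  have "a k * u\<^sub>n n (g \<odot> k \<odot> k\<^sup>\<star>) \<le> (\<Sum>h\<in>C \<inter> source_fibre G (\<s> (g \<odot> k)). a h * u\<^sub>n n (g \<odot> k \<odot> h\<^sup>\<star>))"
    using assms a_support[of k] fibre_card_bounded[OF C]
    by (intro member_le_sum) (auto simp: a_nonneg iter_nonneg source_fibre_def)
  \<comment> \<open>Truncation at 1 does no harm, as the smaller side is already at most 1.\<close>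
  then show ?thesis using assms iter_le_1 by (simp add: step_def)
qed

lemma avg_nonneg: "0 \<le> avg C N a u g"
  by (simp add: avg_def sum_nonneg iter_nonneg)

lemma avg_le_1: "avg C N a u g \<le> 1"
proof -
  have "(\<Sum>n<N. u\<^sub>n n g) \<le> (\<Sum>n<N. 1)" by (intro sum_mono iter_le_1)
  then show ?thesis by (simp add: avg_def divide_le_eq)
qed

lemma avg_continuous: "continuous_map \<T> euclideanreal (avg C N a u)"
proof (cases "N = 0")
  case True
  then have "avg C N a u = (\<lambda>_. 0)" by (auto simp: avg_def)
  then show ?thesis by simp
next
  case False
  then show ?thesis unfolding avg_def by (intro continuous_intros iter_continuous) auto
qed

lemma avg_nonzero: "avg C N a u g \<noteq> 0 \<Longrightarrow> \<exists>n<N. u\<^sub>n n g \<noteq> 0"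
  by (force simp: avg_def intro: ccontr)

text \<open>The \<open>n\<close>-th iterate at \<open>g\<close> is compared with the next one at
  \<open>g \<odot> k\<close>. Among \<open>N\<close> terms only the last has no partner, and it is
  at most 1; hence the error \<open>1 / N\<close>.\<close>

lemma avg_shift:
  assumes "g \<in> arrows G" "k \<in> arrows G" "\<s> g = \<r> k" "a k = 1"
  shows "avg C N a u g \<le> avg C N a u (g \<odot> k) + 1 / real N"
proof (cases N)
  case (Suc m)
  have "(\<Sum>n<N. u\<^sub>n n g) \<le> (\<Sum>n<m. u\<^sub>n (Suc n) (g \<odot> k)) + 1"
    using Suc sum_mono[of "{..<m}" "\<lambda>n. u\<^sub>n n g" "\<lambda>n. u\<^sub>n (Suc n) (g \<odot> k)"] iter_shift[OF assms] iter_le_1[of m g]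
    by simp
  also have "\<dots> \<le> (\<Sum>n<N. u\<^sub>n n (g \<odot> k)) + 1"
    using iter_nonneg[of 0 "g \<odot> k"] unfolding Suc sum.lessThan_Suc_shift by simp
  finally show ?thesis
    by (simp add: avg_def add_divide_distrib[symmetric] divide_right_mono)
qed (simp add: avg_def)

lemma avg_almost_invariant:
  assumes "g \<in> arrows G" "k \<in> arrows G" "\<s> g = \<r> k" "a k = 1" "a (k\<^sup>\<star>) = 1"
  shows "\<bar>avg C N a u g - avg C N a u (g \<odot> k)\<bar> \<le> 1 / real N"
  using avg_shift[OF assms(1-4), of N] avg_shift[of "g \<odot> k" "k\<^sup>\<star>" N] assms by simp

text \<open>Translation by the unit \<open>\<s> g\<close> fixes \<open>g\<close>, so the iterates at
  \<open>g\<close> never drop from 1, and they cannot exceed it.\<close>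

lemma avg_eq_1:
  assumes "g \<in> arrows G" "a (\<s> g) = 1" "u g = 1" "N > 0"
  shows "avg C N a u g = 1"
proof -
  have "u\<^sub>n n g \<ge> 1" for n
  proof (induction n)
    case (Suc n)
    then show ?case using iter_shift[of g "\<s> g" n] assms by simp
  qed (use assms in simp)
  then have "u\<^sub>n n g = 1" for n using iter_le_1[of n g] by (simp add: order_antisym)
  then show ?thesis using assms by (simp add: avg_def)
qed

end

section \<open>Products of boundedly many arrows\<close>

context lch_etale_groupoid
begin

text \<open>The index is shifted: \<open>paths C n\<close> holds products of \<open>n + 1\<close>
  arrows, so \<open>short_paths C N\<close> holds products of one up to \<open>N\<close>
  arrows.\<close>

primrec paths :: "'a set \<Rightarrow> nat \<Rightarrow> 'a set" where
  "paths C 0 = C"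
| "paths C (Suc n) = paths C n \<otimes> C"

definition short_paths :: "'a set \<Rightarrow> nat \<Rightarrow> 'a set" where
  "short_paths C N = (\<Union>n<N. paths C n)"

lemma compact_paths: "compactin \<T> C \<Longrightarrow> compactin \<T> (paths C n)"
  by (induction n) (auto intro: compact_set_mult)

lemma compact_short_paths: "compactin \<T> C \<Longrightarrow> compactin \<T> (short_paths C N)"
  unfolding short_paths_def by (intro compactin_Union) (auto intro: compact_paths)

end

section \<open>Thickening one cover set and spreading over it\<close>

text \<open>The data of one cover set \<open>U\<close>: \<open>f\<close> is a continuous cutoff used
  as the weight of single arrows, \<open>\<phi>\<close> a bump supported in \<open>U\<close> on the
  units, and \<open>H\<close> the precompact subgroupoid that catches the long arrows between points
  of \<open>U\<close>.\<close>

locale colour = lch_etale_groupoid +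
  fixes C U H :: "'a set" and f \<phi> :: "'a \<Rightarrow> real" and N :: nat
  assumes C: "compactin (arrow_top G) C"
    and C_src: "\<And>k. k \<in> C \<Longrightarrow> \<s> k \<in> C" and C_rng: "\<And>k. k \<in> C \<Longrightarrow> \<r> k \<in> C"
    and f_nonneg: "\<And>k. 0 \<le> f k" and f_le_1: "\<And>k. f k \<le> 1"
    and f_support: "\<And>k. f k \<noteq> 0 \<Longrightarrow> k \<in> C"
    and f_cont: "continuous_map (arrow_top G) euclideanreal f"
    and \<phi>_nonneg: "\<And>g. 0 \<le> \<phi> g" and \<phi>_le_1: "\<And>g. \<phi> g \<le> 1"
    and \<phi>_cont: "continuous_map (arrow_top G) euclideanreal \<phi>"
    and \<phi>_support: "\<And>g. g \<in> arrows G \<Longrightarrow> \<phi> (\<s> g) \<noteq> 0 \<Longrightarrow> \<s> g \<in> U"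
    and N: "N > 0"
    and H: "subgroupoid G H" "precompactin (arrow_top G) H"
    and H_paths: "\<And>g. g \<in> short_paths C N \<otimes> C \<otimes> ginv G ` short_paths C N \<Longrightarrow>
                     \<s> g \<in> U \<Longrightarrow> \<r> g \<in> U \<Longrightarrow> g \<in> H"
begin

sublocale thick: weight G C f "\<lambda>g. \<phi> (\<s> g)"
proof unfold_locales
  show "continuous_map \<T> euclideanreal (\<lambda>g. \<phi> (\<s> g))"
    using continuous_map_compose[OF continuous_src \<phi>_cont] by (simp add: o_def)
qed (use C f_nonneg f_support f_cont \<phi>_nonneg \<phi>_le_1 in auto)

definition \<Psi> :: "'a \<Rightarrow> real" where "\<Psi> = avg C N f (\<lambda>g. \<phi> (\<s> g))"

lemma \<Psi>_nonneg: "0 \<le> \<Psi> g" and \<Psi>_le_1: "\<Psi> g \<le> 1"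
  and \<Psi>_cont: "continuous_map \<T> euclideanreal \<Psi>"
  unfolding \<Psi>_def using thick.avg_nonneg thick.avg_le_1 thick.avg_continuous by auto

text \<open>A step at \<open>g\<close> evaluates the previous function at
  \<open>g \<odot> k\<^sup>\<star>\<close>, whose source \<open>\<r> k\<close> depends on
  \<open>k\<close> alone. So \<open>\<Psi>\<close> is in effect a function on the units.\<close>

lemma thick_iter_src: "g \<in> arrows G \<Longrightarrow> thick.u\<^sub>n n g = thick.u\<^sub>n n (\<s> g)"
proof (induction n arbitrary: g)
  case (Suc n)
  have "thick.u\<^sub>n n (g \<odot> k\<^sup>\<star>) = thick.u\<^sub>n n (\<s> g \<odot> k\<^sup>\<star>)" if "k \<in> C \<inter> source_fibre G (\<s> g)" for k
    using Suc.IH[of "g \<odot> k\<^sup>\<star>"] Suc.IH[of "\<s> g \<odot> k\<^sup>\<star>"] Suc.prems that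
    by (simp add: source_fibre_def)
  then have "step C f (thick.u\<^sub>n n) g = step C f (thick.u\<^sub>n n) (\<s> g)"
    unfolding step_def[of C f "thick.u\<^sub>n n"] using Suc.prems
    by (auto intro!: arg_cong[where f = "min 1"] sum.cong)
  then show ?case by simp
qed simp

lemma \<Psi>_src: "g \<in> arrows G \<Longrightarrow> \<Psi> (\<s> g) = \<Psi> g"
  by (simp add: \<Psi>_def avg_def thick_iter_src[of g])

lemma \<Psi>_almost_invariant:
  assumes "k \<in> arrows G" "f k = 1" "f (k\<^sup>\<star>) = 1"
  shows "\<bar>\<Psi> (\<r> k) - \<Psi> (\<s> k)\<bar> \<le> 1 / real N"
  \<comment> \<open>The unit \<open>\<r> k\<close> translated by \<open>k\<close> is
    \<open>k\<close>, where \<open>\<Psi>\<close> takes its value at \<open>\<s> k\<close>.\<close>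
  using thick.avg_almost_invariant[of "\<r> k" k N] assms by (simp add: \<Psi>_src) (simp add: \<Psi>_def)

lemma \<Psi>_eq_1:
  assumes "g \<in> arrows G" "f (\<s> g) = 1" "\<phi> (\<s> g) = 1"
  shows "\<Psi> (\<s> g) = 1"
  using thick.avg_eq_1[of "\<s> g" N] assms N by (simp add: \<Psi>_def)

text \<open>Every step contributes the arrow \<open>k\<close> of a nonzero summand. The start
  contributes the unit itself as a path of one arrow, which matches the index shift in
  \<open>paths\<close>.\<close>

lemma thick_iter_path:
  "g \<in> arrows G \<Longrightarrow> \<s> g \<in> C \<Longrightarrow> thick.u\<^sub>n n g \<noteq> 0 \<Longrightarrow> \<exists>p\<in>paths C n. \<s> p = \<s> g \<and> \<r> p \<in> U"
proof (induction n arbitrary: g)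
  case 0
  then show ?case using \<phi>_support by (intro bexI[of _ "\<s> g"]) auto
next
  case (Suc n)
  obtain k where k: "k \<in> C" "k \<in> source_fibre G (\<s> g)" "thick.u\<^sub>n n (g \<odot> k\<^sup>\<star>) \<noteq> 0"
    using step_nonzero[of C f "thick.u\<^sub>n n" g] Suc.prems(3) by auto
  then have kA: "k \<in> arrows G" "\<s> k = \<s> g" by (auto simp: source_fibre_def)
  then obtain p where p: "p \<in> paths C n" "\<s> p = \<r> k" "\<r> p \<in> U"
    using Suc.IH[of "g \<odot> k\<^sup>\<star>"] k C_rng Suc.prems by auto
  moreover have "p \<in> arrows G" using p(1) compact_paths[OF C] compact_arrows by blast
  ultimately show ?case using k kA by (intro bexI[of _ "p \<odot> k"]) (auto simp: set_mult_def)
qed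

lemma \<Psi>_path:
  assumes "g \<in> C" "\<Psi> g \<noteq> 0"
  shows "\<exists>p\<in>short_paths C N. \<s> p = \<s> g \<and> \<r> p \<in> U"
proof -
  obtain n where "n < N" "thick.u\<^sub>n n g \<noteq> 0"
    using assms(2) thick.avg_nonzero unfolding \<Psi>_def by blast
  then show ?thesis
    using thick_iter_path[of g n] assms(1) compact_arrows[OF C] C_src by (auto simp: short_paths_def)
qed

text \<open>The cutoff factors force \<open>\<Psi>\<close> to be nonzero at both ends of an arrow of
  nonzero weight, so both ends are joined to \<open>U\<close> by short paths. They equal 1 as soon
  as \<open>\<Psi>\<close> is at least \<open>1 / N\<close>; units with smaller
  \<open>\<Psi>\<close> contribute little in the end.\<close>

definition \<eta> :: "'a \<Rightarrow> real" where "\<eta> k = f k * (min 1 (N * \<Psi> (\<s> k)) * min 1 (N * \<Psi> (\<r> k)))"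

lemma \<eta>_nonneg: "0 \<le> \<eta> k" and \<eta>_le_1: "\<eta> k \<le> 1"
  unfolding \<eta>_def using f_nonneg f_le_1 \<Psi>_nonneg by (auto intro!: mult_le_one mult_nonneg_nonneg)

lemma \<eta>_eq_1: "f k = 1 \<Longrightarrow> 1 \<le> N * \<Psi> (\<s> k) \<Longrightarrow> 1 \<le> N * \<Psi> (\<r> k) \<Longrightarrow> \<eta> k = 1"
  by (simp add: \<eta>_def)

sublocale spread: weight G C \<eta> \<eta>
proof -
  have cont: "continuous_map \<T> euclideanreal \<eta>"
    unfolding \<eta>_def
    using f_cont continuous_map_compose[OF continuous_src \<Psi>_cont] continuous_map_compose[OF continuous_rng \<Psi>_cont]
    by (intro continuous_intros) (auto simp: o_def)
  have supp: "k \<in> C" if "\<eta> k \<noteq> 0" for k using that f_support[of k] by (auto simp: \<eta>_def)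
  show "weight G C \<eta> \<eta>"
    by unfold_locales (use C cont supp \<eta>_nonneg \<eta>_le_1 in auto)
qed

text \<open>Every arrow reached by the propagation is conjugated into \<open>H\<close> by the paths \<open>c x\<close> leading from its
  end points into \<open>U\<close>.\<close>

lemma spread_support:
  obtains Q where "compactin \<T> Q" "\<And>n g. g \<in> arrows G \<Longrightarrow> spread.u\<^sub>n n g \<noteq> 0 \<Longrightarrow> g \<in> Q"
proof -
  define R where "R = short_paths C N"
  have R: "compactin \<T> R" unfolding R_def using C by (rule compact_short_paths)
  have RA: "p \<in> arrows G" if "p \<in> R" for p using compact_arrows[OF R] that by auto
  have CA: "p \<in> arrows G" if "p \<in> C" for p using compact_arrows[OF C] that by auto
  define P where "P x p \<longleftrightarrow> p \<in> R \<and> \<s> p = x \<and> \<r> p \<in> U" for x p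
  define c where "c x = (SOME p. P x p)" for x
  define W where "W = {x. \<exists>p. P x p}"
  have c: "c x \<in> R" "c x \<in> arrows G" "\<s> (c x) = x" "\<r> (c x) \<in> U" if "x \<in> W" for x
  proof -
    have "\<exists>p. P x p" using that by (simp add: W_def)
    then have "P x (c x)" unfolding c_def by (rule someI_ex)
    then show "c x \<in> R" "c x \<in> arrows G" "\<s> (c x) = x" "\<r> (c x) \<in> U" using RA by (auto simp: P_def)
  qed
  define \<theta> where "\<theta> g = c (\<r> g) \<odot> g \<odot> (c (\<s> g))\<^sup>\<star>" for g
  define S where "S = {g \<in> arrows G. \<s> g \<in> W \<and> \<r> g \<in> W \<and> \<theta> g \<in> H}"
  have \<eta>S: "g \<in> S" if "\<eta> g \<noteq> 0" for g
  proof -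
    have g: "g \<in> C" "\<Psi> (\<s> g) \<noteq> 0" "\<Psi> (\<r> g) \<noteq> 0" using that f_support by (auto simp: \<eta>_def)
    then have W: "\<s> g \<in> W" "\<r> g \<in> W"
      using \<Psi>_path[of "\<s> g"] \<Psi>_path[of "\<r> g"] C_src C_rng CA by (auto simp: W_def P_def R_def)
    have "\<theta> g \<in> R \<otimes> C \<otimes> ginv G ` R"
      unfolding \<theta>_def set_mult_def using c[OF W(1)] c[OF W(2)] g(1) CA[OF g(1)] by fastforce
    moreover have "\<s> (\<theta> g) \<in> U" "\<r> (\<theta> g) \<in> U"
      using c[OF W(1)] c[OF W(2)] CA[OF g(1)] by (auto simp: \<theta>_def)
    ultimately have "\<theta> g \<in> H" using H_paths by (simp add: R_def)
    then show ?thesis using W CA[OF g(1)] by (simp add: S_def)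
  qed
  \<comment> \<open>The paths at the common unit cancel, so \<open>\<theta>\<close> is
    multiplicative and \<open>S\<close> inherits closure under products from
    \<open>H\<close>.\<close>
  have S_mult: "g \<odot> k \<in> S" if gk: "g \<in> S" "k \<in> S" "\<s> g = \<r> k" for g k
  proof -
    have A: "g \<in> arrows G" "k \<in> arrows G" using gk by (auto simp: S_def)
    have W: "\<s> k \<in> W" "\<r> k \<in> W" "\<r> g \<in> W" using gk by (auto simp: S_def)
    note cW = c[OF W(1)] c[OF W(2)] c[OF W(3)]
    have "\<theta> g \<odot> \<theta> k = c (\<r> g) \<odot> g \<odot> (c (\<r> k))\<^sup>\<star> \<odot> (c (\<r> k) \<odot> (k \<odot> (c (\<s> k))\<^sup>\<star>))"
      unfolding \<theta>_def gk(3) using A cW gk(3) by (simp add: assoc)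
    also have "\<dots> = c (\<r> g) \<odot> g \<odot> ((c (\<r> k))\<^sup>\<star> \<odot> (c (\<r> k) \<odot> (k \<odot> (c (\<s> k))\<^sup>\<star>)))"
      using A cW gk(3) by (simp add: assoc)
    also have "\<dots> = c (\<r> g) \<odot> g \<odot> (k \<odot> (c (\<s> k))\<^sup>\<star>)"
      using A cW gk(3) by (subst inv_mult_cancel_left) auto
    also have "\<dots> = \<theta> (g \<odot> k)"
      using A cW gk(3) by (simp add: \<theta>_def assoc)
    finally have "\<theta> (g \<odot> k) = \<theta> g \<odot> \<theta> k" by simp
    moreover have "\<theta> g \<odot> \<theta> k \<in> H"
      using H(1) gk A cW unfolding subgroupoid_def by (auto simp: S_def \<theta>_def)
    ultimately show ?thesis using A W gk(3) by (simp add: S_def)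
  qed
  have S: "g \<in> S" if "g \<in> arrows G" "spread.u\<^sub>n n g \<noteq> 0" for n g
    using that
  proof (induction n arbitrary: g)
    case (Suc n)
    obtain k where k: "k \<in> source_fibre G (\<s> g)" "\<eta> k \<noteq> 0" "spread.u\<^sub>n n (g \<odot> k\<^sup>\<star>) \<noteq> 0"
      using step_nonzero[of C \<eta> "spread.u\<^sub>n n" g] Suc.prems(2) by auto
    then have "k \<in> arrows G" "\<s> k = \<s> g" by (auto simp: source_fibre_def)
    then show ?case using S_mult[of "g \<odot> k\<^sup>\<star>" k] \<eta>S[OF k(2)] Suc.IH[of "g \<odot> k\<^sup>\<star>"] Suc.prems k(3)
      by simp
  qed (simp add: \<eta>S)
  \<comment> \<open>Undoing the conjugation writes every arrow of \<open>S\<close> as a product from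
    three compact sets; the closure of \<open>H\<close> serves as the middle one.\<close>
  define Q where "Q = ginv G ` R \<otimes> (\<T> closure_of H) \<otimes> R"
  have "S \<subseteq> Q"
  proof
    fix g assume "g \<in> S"
    then have g: "g \<in> arrows G" "\<s> g \<in> W" "\<r> g \<in> W" "\<theta> g \<in> H" by (auto simp: S_def)
    note cW = c[OF g(2)] c[OF g(3)]
    have "\<theta> g \<in> \<T> closure_of H"
      using g(4) H(2) closure_of_subset unfolding precompactin_def by blast
    then have "(c (\<r> g))\<^sup>\<star> \<odot> \<theta> g \<in> ginv G ` R \<otimes> (\<T> closure_of H)"
      unfolding set_mult_def using cW g(1) by (fastforce simp: \<theta>_def)
    then have "(c (\<r> g))\<^sup>\<star> \<odot> \<theta> g \<odot> c (\<s> g) \<in> Q"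
      unfolding Q_def set_mult_def[of _ R] using cW g(1) by (fastforce simp: \<theta>_def)
    moreover have "(c (\<r> g))\<^sup>\<star> \<odot> \<theta> g \<odot> c (\<s> g) = g"
      using cW g(1) by (simp add: \<theta>_def assoc)
    ultimately show "g \<in> Q" by simp
  qed
  moreover have "compactin \<T> Q"
    unfolding Q_def using H(2) R by (intro compact_set_mult compact_inv) (auto simp: precompactin_def)
  ultimately show thesis using that S by blast
qed

end

section \<open>Normalising the spread mass to densities\<close>

text \<open>With \<open>D\<close> and \<open>E\<close> the two totals, each difference is
  \<open>(p x - q x) / D\<close> plus \<open>q x / E * (E - D) / D\<close>. The first parts sum to
  at most \<open>card A * e\<close>; so do the second, because the \<open>q x / E\<close> add up to
  1 and \<open>\<bar>D - E\<bar>\<close> obeys the same bound.\<close>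

lemma sum_abs_normalised_diff_le:
  fixes p q :: "'b \<Rightarrow> real"
  assumes "finite A" and pq: "\<And>x. x \<in> A \<Longrightarrow> \<bar>p x - q x\<bar> \<le> e" and q: "\<And>x. x \<in> A \<Longrightarrow> 0 \<le> q x"
    and "1 \<le> sum p A" "1 \<le> sum q A"
  shows "(\<Sum>x\<in>A. \<bar>p x / sum p A - q x / sum q A\<bar>) \<le> 2 * real (card A) * e"
proof -
  define D E where "D = sum p A" and "E = sum q A"
  have D: "1 \<le> D" and E: "1 \<le> E" using assms by (auto simp: D_def E_def)
  have "\<bar>D - E\<bar> \<le> (\<Sum>x\<in>A. \<bar>p x - q x\<bar>)"
    unfolding D_def E_def sum_subtractf[symmetric] by (rule sum_abs)
  also have le: "(\<Sum>x\<in>A. \<bar>p x - q x\<bar>) \<le> real (card A) * e"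
    using sum_bounded_above[of A "\<lambda>x. \<bar>p x - q x\<bar>" e] pq by simp
  finally have DE: "\<bar>D - E\<bar> \<le> real (card A) * e" .
  have "\<bar>p x / D - q x / E\<bar> \<le> \<bar>p x - q x\<bar> + q x / E * \<bar>D - E\<bar>" if "x \<in> A" for x
  proof -
    have "p x / D - q x / E = (p x - q x) / D + q x / E * (E - D) / D"
      using D E by (simp add: field_simps)
    also have "\<bar>\<dots>\<bar> \<le> \<bar>(p x - q x) / D\<bar> + \<bar>q x / E * (E - D) / D\<bar>" by (rule abs_triangle_ineq)
    also have "\<dots> = (\<bar>p x - q x\<bar> + q x / E * \<bar>D - E\<bar>) / D"
      using D E q[OF that] by (simp add: abs_mult add_divide_distrib abs_minus_commute)
    also have "\<dots> \<le> \<bar>p x - q x\<bar> + q x / E * \<bar>D - E\<bar>"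
      using D E q[OF that] mult_left_mono[of 1 D "\<bar>p x - q x\<bar> + q x / E * \<bar>D - E\<bar>"]
      by (simp add: divide_le_eq)
    finally show ?thesis .
  qed
  then have "(\<Sum>x\<in>A. \<bar>p x / D - q x / E\<bar>) \<le> (\<Sum>x\<in>A. \<bar>p x - q x\<bar> + q x / E * \<bar>D - E\<bar>)"
    by (rule sum_mono)
  also have "\<dots> = (\<Sum>x\<in>A. \<bar>p x - q x\<bar>) + \<bar>D - E\<bar>"
    using E by (simp add: sum.distrib sum_distrib_right[symmetric] sum_divide_distrib[symmetric] E_def)
  also have "\<dots> \<le> 2 * real (card A) * e" using le DE by simp
  finally show ?thesis by (simp add: D_def E_def)
qed

context colour
begin

text \<open>The bound \<open>M\<close> on the size of the fibres of the support is only known after \<open>N\<close>, so the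
  propagation is averaged over a second, much larger number \<open>n\<close> of steps.\<close>

lemma invariant_density:
  obtains Q P where "compactin \<T> Q" "continuous_map \<T> euclideanreal P"
    "\<And>g. 0 \<le> P g" "\<And>g. P g \<noteq> 0 \<Longrightarrow> g \<in> Q"
    "\<And>A x. finite A \<Longrightarrow> A \<subseteq> source_fibre G x \<Longrightarrow> sum P A \<le> 1"
    "\<And>A x. finite A \<Longrightarrow> A \<subseteq> source_fibre G x \<Longrightarrow> Q \<inter> source_fibre G x \<subseteq> A \<Longrightarrow> x \<in> units G \<Longrightarrow>
       f x = 1 \<Longrightarrow> 1 \<le> N * \<Psi> x \<Longrightarrow> sum P A = 1"
    "\<And>A k. finite A \<Longrightarrow> A \<subseteq> source_fibre G (\<r> k) \<Longrightarrow> k \<in> arrows G \<Longrightarrow> f k = 1 \<Longrightarrow> f (k\<^sup>\<star>) = 1 \<Longrightarrow>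
       f (\<s> k) = 1 \<Longrightarrow> f (\<r> k) = 1 \<Longrightarrow> 1 \<le> N * \<Psi> (\<s> k) \<Longrightarrow> 1 \<le> N * \<Psi> (\<r> k) \<Longrightarrow>
       (\<Sum>g\<in>A. \<bar>P g - P (g \<odot> k)\<bar>) \<le> 1 / N"
proof -
  obtain Q where Q: "compactin \<T> Q" and supp: "\<And>n g. g \<in> arrows G \<Longrightarrow> spread.u\<^sub>n n g \<noteq> 0 \<Longrightarrow> g \<in> Q"
    using spread_support by metis
  obtain M where fin: "\<And>x. finite (Q \<inter> source_fibre G x)" and M: "\<And>x. card (Q \<inter> source_fibre G x) \<le> M"
    using fibre_card_bounded[OF Q] by metis
  \<comment> \<open>At most \<open>2 * M\<close> arrows matter for a given \<open>k\<close>, so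
    normalisation turns the error \<open>1 / n\<close> into \<open>4 * M / n\<close>, which is at
    most \<open>1 / N\<close>. The added 1 keeps \<open>n\<close> positive when
    \<open>M = 0\<close>.\<close>
  define n where "n = 4 * M * N + 1"
  have n: "n > 0" by (simp add: n_def)
  \<comment> \<open>Set to 0 off the arrows, because \<open>Q\<close> is known to contain the
    support only among arrows.\<close>
  define F where "F g = (if g \<in> arrows G then avg C n \<eta> \<eta> g else 0)" for g
  have F_nonneg: "0 \<le> F g" for g using spread.avg_nonneg by (simp add: F_def)
  have F_cont: "continuous_map \<T> euclideanreal F"
    by (rule continuous_map_eq[OF spread.avg_continuous[of n]]) (simp add: F_def)
  have F_supp: "g \<in> Q" if "F g \<noteq> 0" for g
    using that spread.avg_nonzero[of n g] supp by (auto simp: F_def split: if_splits)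
  have F_1: "F x = 1" if "x \<in> units G" "f x = 1" "1 \<le> N * \<Psi> x" for x
  proof -
    have "x \<in> arrows G" "\<s> x = x" "\<r> x = x" using that(1) by (auto simp: units_def)
    then show ?thesis using spread.avg_eq_1[of x n] \<eta>_eq_1[of x] that n by (simp add: F_def)
  qed
  define D where "D g = (\<Sum>h\<in>Q \<inter> source_fibre G (\<s> g). F h)" for g
  have D_cont: "continuous_map \<T> euclideanreal D"
    using continuous_fibre_sum[OF Q F_cont F_supp, of "\<lambda>_ _. 1"] by (simp add: D_def[abs_def] case_prod_unfold)
  \<comment> \<open>The unit lies in its own fibre and has \<open>F\<close>-value 1.\<close>
  have D_ge_1: "1 \<le> D g" if "g \<in> arrows G" "f (\<s> g) = 1" "1 \<le> N * \<Psi> (\<s> g)" for g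
  proof -
    have u: "\<s> g \<in> units G" using that by (simp add: units_def)
    have "\<s> g \<in> Q \<inter> source_fibre G (\<s> g)"
      using F_1[OF u] F_supp[of "\<s> g"] that by (auto simp: source_fibre_def)
    then have "F (\<s> g) \<le> D g" unfolding D_def using fin F_nonneg by (intro member_le_sum) auto
    then show ?thesis using F_1[OF u] that by simp
  qed
  \<comment> \<open>\<open>D\<close> is constant on source fibres. The maximum with 1 keeps
    \<open>P\<close> continuous with mass at most 1, and is inactive where \<open>D_ge_1\<close>
    applies, giving mass exactly 1.\<close>
  define P where "P g = F g / max 1 (D g)" for g
  have P_nonneg: "0 \<le> P g" for g using F_nonneg by (simp add: P_def)
  have P_supp: "g \<in> Q" if "P g \<noteq> 0" for g using that F_supp[of g] by (auto simp: P_def)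
  have sumP: "sum P A = (if A = {} then 0 else sum F A / max 1 (\<Sum>h\<in>Q \<inter> source_fibre G x. F h))"
    if "A \<subseteq> source_fibre G x" for A x
  proof -
    have "P g = F g / max 1 (\<Sum>h\<in>Q \<inter> source_fibre G x. F h)" if "g \<in> A" for g
      using that \<open>A \<subseteq> source_fibre G x\<close> by (auto simp: P_def D_def source_fibre_def)
    then show ?thesis by (simp add: sum_divide_distrib)
  qed
  show thesis
  proof (rule that[of Q P])
    show "compactin \<T> Q" by (rule Q)
    show "continuous_map \<T> euclideanreal P"
      unfolding P_def using F_cont D_cont by (intro continuous_intros) auto
    show "0 \<le> P g" for g by (rule P_nonneg)
    show "g \<in> Q" if "P g \<noteq> 0" for g using that by (rule P_supp)
  next
    fix A x assume A: "finite A" "A \<subseteq> source_fibre G x"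
    have "sum F A = sum F (A \<inter> (Q \<inter> source_fibre G x))"
      using A F_supp by (intro sum.mono_neutral_right) auto
    also have "\<dots> \<le> sum F (Q \<inter> source_fibre G x)"
      using fin F_nonneg by (intro sum_mono2) auto
    finally show "sum P A \<le> 1" unfolding sumP[OF A(2)] by (auto simp: divide_le_eq)
  next
    fix A x assume A: "finite A" "A \<subseteq> source_fibre G x" "Q \<inter> source_fibre G x \<subseteq> A"
      and x: "x \<in> units G" "f x = 1" "1 \<le> N * \<Psi> x"
    have xx: "x \<in> arrows G" "\<s> x = x" using x(1) by (auto simp: units_def)
    have "sum F A = D x" unfolding D_def xx
      using A F_supp by (intro sum.mono_neutral_right) auto
    moreover have "1 \<le> D x" using D_ge_1[of x] x xx by simp
    ultimately show "sum P A = 1" using sumP[OF A(2)] by (auto simp: D_def xx)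
  next
    fix A k assume A: "finite A" "A \<subseteq> source_fibre G (\<r> k)"
      and k: "k \<in> arrows G" "f k = 1" "f (k\<^sup>\<star>) = 1" "f (\<s> k) = 1" "f (\<r> k) = 1"
        "1 \<le> N * \<Psi> (\<s> k)" "1 \<le> N * \<Psi> (\<r> k)"
    \<comment> \<open>All places where \<open>P g\<close> or \<open>P (g \<odot> k)\<close> can be
      nonzero: sums over \<open>B\<close> see the full mass at both ends of \<open>k\<close>, and
      any \<open>A\<close> may be exchanged for \<open>B\<close>.\<close>
    define B where "B = {g \<in> source_fibre G (\<r> k). g \<in> Q \<or> g \<odot> k \<in> Q}"
    define B' where "B' = {g \<in> source_fibre G (\<r> k). g \<odot> k \<in> Q}"
    have bij: "bij_betw (\<lambda>g. g \<odot> k) B' (Q \<inter> source_fibre G (\<s> k))"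
      using bij_betw_mult_right[OF k(1)] unfolding bij_betw_def inj_on_def B'_def by blast
    have B': "finite B'" "card B' \<le> M"
      using bij_betw_finite[OF bij] fin bij_betw_same_card[OF bij] M by auto
    have BB: "B = (Q \<inter> source_fibre G (\<r> k)) \<union> B'" by (auto simp: B_def B'_def)
    have B: "finite B" "card B \<le> 2 * M"
      using B' fin M[of "\<r> k"] card_Un_le[of "Q \<inter> source_fibre G (\<r> k)" B'] by (auto simp: BB)
    have D1: "sum F B = D (\<r> k)"
      unfolding D_def src_rng[OF k(1)] using B F_supp by (intro sum.mono_neutral_right) (auto simp: B_def)
    have "(\<Sum>g\<in>B. F (g \<odot> k)) = (\<Sum>g\<in>B'. F (g \<odot> k))"
      using B F_supp by (intro sum.mono_neutral_right) (auto simp: B_def B'_def)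
    also have "\<dots> = D k" unfolding D_def by (rule sum.reindex_bij_betw[OF bij])
    finally have D2: "(\<Sum>g\<in>B. F (g \<odot> k)) = D k" .
    have Dr: "1 \<le> D (\<r> k)" and Ds: "1 \<le> D k"
      using D_ge_1[of "\<r> k"] D_ge_1[of k] k by auto
    have P1: "P g = F g / D (\<r> k)" "P (g \<odot> k) = F (g \<odot> k) / D k" if "g \<in> source_fibre G (\<r> k)" for g
      using that k(1) Dr Ds by (auto simp: P_def D_def source_fibre_def)
    have Fk: "\<bar>F g - F (g \<odot> k)\<bar> \<le> 1 / n" if "g \<in> source_fibre G (\<r> k)" for g
      using that k \<eta>_eq_1[of k] \<eta>_eq_1[of "k\<^sup>\<star>"] spread.avg_almost_invariant[of g k n]
      by (auto simp: F_def source_fibre_def)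
    have "(\<Sum>g\<in>A. \<bar>P g - P (g \<odot> k)\<bar>) \<le> (\<Sum>g\<in>A \<union> B. \<bar>P g - P (g \<odot> k)\<bar>)"
      using A B by (intro sum_mono2) auto
    also have "\<dots> = (\<Sum>g\<in>B. \<bar>P g - P (g \<odot> k)\<bar>)"
    proof (rule sum.mono_neutral_right)
      show "\<forall>g\<in>A \<union> B - B. \<bar>P g - P (g \<odot> k)\<bar> = 0"
      proof
        fix g assume "g \<in> A \<union> B - B"
        then have "g \<notin> Q" "g \<odot> k \<notin> Q" using A(2) by (auto simp: B_def)
        then have "P g = 0" "P (g \<odot> k) = 0" using P_supp by blast+
        then show "\<bar>P g - P (g \<odot> k)\<bar> = 0" by simp
      qed
    qed (use A B in auto)
    also have "\<dots> = (\<Sum>g\<in>B. \<bar>F g / sum F B - F (g \<odot> k) / (\<Sum>g\<in>B. F (g \<odot> k))\<bar>)"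
      unfolding D2 D1 using P1 by (intro sum.cong) (auto simp: B_def)
    also have "\<dots> \<le> 2 * real (card B) * (1 / n)"
      using B Fk F_nonneg D2 D1 Dr Ds
      by (intro sum_abs_normalised_diff_le) (auto simp: B_def)
    also have "\<dots> \<le> 4 * M / n"
    proof -
      have "2 * real (card B) \<le> 4 * M" using B(2) by simp
      then show ?thesis using n by (simp add: divide_right_mono)
    qed
    also have "\<dots> \<le> 1 / N"
    proof -
      have "4 * real M * real N \<le> real n" by (simp add: n_def)
      then show ?thesis using n N by (simp add: field_simps)
    qed
    finally show "(\<Sum>g\<in>A. \<bar>P g - P (g \<odot> k)\<bar>) \<le> 1 / N" .
  qed
qed

end

section \<open>Gluing the densities\<close>

text \<open>The same splitting as for sums, with \<open>b / t \<le> 1\<close> in front of the change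
  of denominator.\<close>

lemma abs_normalised_diff_le:
  fixes a b s t :: real
  assumes "1 \<le> s" "1 \<le> t" "0 \<le> b" "b \<le> t"
  shows "\<bar>a / s - b / t\<bar> \<le> \<bar>a - b\<bar> + \<bar>s - t\<bar>"
proof -
  have "a / s - b / t = (a - b) / s + b / t * ((t - s) / s)"
    using assms by (simp add: field_simps)
  also have "\<bar>\<dots>\<bar> \<le> \<bar>(a - b) / s\<bar> + \<bar>b / t * ((t - s) / s)\<bar>" by (rule abs_triangle_ineq)
  also have "\<bar>(a - b) / s\<bar> \<le> \<bar>a - b\<bar>"
    using assms mult_left_mono[of 1 s "\<bar>a - b\<bar>"] by (simp add: divide_le_eq)
  also have "\<bar>b / t * ((t - s) / s)\<bar> = b / t * (\<bar>s - t\<bar> / s)"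
    using assms by (simp add: abs_mult abs_minus_commute)
  also have "\<dots> \<le> 1 * \<bar>s - t\<bar>"
    using assms mult_left_mono[of 1 s "\<bar>s - t\<bar>"] by (intro mult_mono) (auto simp: divide_le_eq)
  finally show ?thesis by simp
qed

context lch_etale_groupoid
begin

lemma precompact_open_superset:
  assumes "compactin \<T> E"
  obtains V L where "openin \<T> V" "precompactin \<T> V" "compactin \<T> L" "E \<subseteq> V" "V \<subseteq> L"
proof -
  obtain V L where VL: "openin \<T> V" "compactin \<T> L" "closedin \<T> L" "E \<subseteq> V" "V \<subseteq> L"
    using assms locally_compact Hausdorff locally_compact_space_compact_closed_compact by metis
  then have "\<T> closure_of V \<subseteq> L" by (simp add: closure_of_minimal)
  then have "precompactin \<T> V"
    using VL closed_compactin closedin_closure_of openin_subset unfolding precompactin_def by metis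
  then show thesis using that VL by blast
qed

text \<open>Where \<open>\<Psi> i < 1 / N\<close> the density \<open>P i\<close> is not controlled,
  but its weight there is below \<open>1 / N\<close> too. Both the mass and the invariance estimate
  split into these two cases.\<close>

lemma dad_cover_property_imp_amenable:
  assumes dad: "dad_cover_property G d"
  shows "amenable G"
  unfolding amenable_def
proof (intro allI impI, elim conjE)
  fix K and \<epsilon> :: real
  assume K: "compactin \<T> K" and \<epsilon>: "\<epsilon> > 0"
  \<comment> \<open>Each of the \<open>d + 1\<close> cover sets costs at most
    \<open>(d + 3) / N\<close> in the invariance estimate; \<open>d + 4\<close> leaves slack and
    covers the mass estimate as well.\<close>
  obtain N :: nat where N0: "real ((d + 1) * (d + 4)) / \<epsilon> < real N"
    using reals_Archimedean2 by blast
  then have N: "N > 0" using \<epsilon> by (metis divide_nonneg_pos gr0I of_nat_0 of_nat_0_le_iff not_less)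
  have N\<epsilon>: "real ((d + 1) * (d + 4)) / N < \<epsilon>" using N0 N \<epsilon> by (simp add: field_simps)
  have KA: "k \<in> arrows G" if "k \<in> K" for k using K compact_arrows that by auto
  \<comment> \<open>\<open>f\<close> must be 1 on inverses, for two-sided translation bounds, and on
    the ends of \<open>K\<close>, where the averages are to equal 1.\<close>
  define K1 where "K1 = K \<union> ginv G ` K \<union> \<s> ` K \<union> \<r> ` K"
  have K1: "compactin \<T> K1"
    unfolding K1_def using K compact_inv image_compactin continuous_src continuous_rng
    by (intro compactin_Un) auto
  obtain V L where V: "openin \<T> V" "compactin \<T> L" "K1 \<subseteq> V" "V \<subseteq> L"
    using precompact_open_superset[OF K1] by metis
  have "K1 \<subseteq> (\<Union>i\<in>{()}. V)" using V by simp
  then obtain f' :: "unit \<Rightarrow> 'a \<Rightarrow> real" and Z where f':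
    "continuous_map \<T> euclideanreal (f' ())" "\<And>i x. 0 \<le> f' i x" "\<And>i x. f' i x \<le> 1"
    "Z () \<subseteq> V" "\<And>x. f' () x \<noteq> 0 \<Longrightarrow> x \<in> Z ()" "\<And>x. x \<in> K1 \<Longrightarrow> f' () x = 1"
    using compact_cover_bumps[OF completely_regular K1, of "{()}" "\<lambda>_. V"] V(1)
    by (metis finite.emptyI finite.insertI singletonD singletonI)
  define f where "f = f' ()"
  have f: "continuous_map \<T> euclideanreal f" "\<And>x. 0 \<le> f x" "\<And>x. f x \<le> 1"
    "\<And>x. f x \<noteq> 0 \<Longrightarrow> x \<in> L" "\<And>x. x \<in> K1 \<Longrightarrow> f x = 1"
    unfolding f_def using f'(1-3,6) f'(4,5) V(4) by (blast+)
  define C where "C = L \<union> \<s> ` L \<union> \<r> ` L"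
  have C: "compactin \<T> C"
    unfolding C_def using V(2) image_compactin continuous_src continuous_rng
    by (intro compactin_Un) auto
  have C_sr: "\<s> k \<in> C" "\<r> k \<in> C" if "k \<in> C" for k
    using that compact_arrows[OF V(2)] by (auto simp: C_def)
  \<comment> \<open>Home of the conjugates of arrows of \<open>C\<close> by short paths, with up to
    \<open>2 * N + 1\<close> factors.\<close>
  define R where "R = short_paths C N \<otimes> C \<otimes> ginv G ` short_paths C N"
  have "compactin \<T> (K1 \<union> R)"
    unfolding R_def using K1 C
    by (intro compactin_Un compact_set_mult compact_inv compact_short_paths)
  then obtain Kb L' where "openin \<T> Kb" "precompactin \<T> Kb" "compactin \<T> L'" "K1 \<union> R \<subseteq> Kb" "Kb \<subseteq> L'"
    by (rule precompact_open_superset)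
  then have Kb: "openin \<T> Kb" "precompactin \<T> Kb" "K1 \<subseteq> Kb" "R \<subseteq> Kb" by auto
  from dad[unfolded dad_cover_property_def, THEN spec, THEN mp, OF conjI[OF Kb(1,2)]]
  obtain U where U: "\<forall>i\<le>d. openin (unit_top G) (U i)"
      "\<s> ` Kb \<union> \<r> ` Kb \<subseteq> (\<Union>i \<le> d. U i)"
      "\<forall>i\<le>d. \<exists>H. subgroupoid G H \<and> precompactin \<T> H \<and>
             {g \<in> Kb. \<s> g \<in> U i \<and> \<r> g \<in> U i} \<subseteq> H"
    by (elim exE conjE)
  obtain H where H: "\<And>i. i \<le> d \<Longrightarrow> subgroupoid G (H i) \<and> precompactin \<T> (H i) \<and>
             {g \<in> Kb. \<s> g \<in> U i \<and> \<r> g \<in> U i} \<subseteq> H i"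
    using U(3) by metis
  \<comment> \<open>\<open>U i\<close> is open among the units only, while the bumps are built on
    all arrows.\<close>
  obtain O' where O': "\<And>i. i \<le> d \<Longrightarrow> openin \<T> (O' i) \<and> U i = O' i \<inter> units G"
    using U(1) unfolding unit_top_def openin_subtopology by metis
  define K0 where "K0 = \<s> ` K \<union> \<r> ` K"
  have K0: "compactin \<T> K0"
    unfolding K0_def using K image_compactin continuous_src continuous_rng
    by (intro compactin_Un) auto
  have "K0 \<subseteq> \<s> ` Kb \<union> \<r> ` Kb" using Kb(3) by (auto simp: K0_def K1_def)
  then have "K0 \<subseteq> (\<Union>i\<in>{..d}. O' i)" using U(2) O' by fastforce
  then obtain \<phi> :: "nat \<Rightarrow> 'a \<Rightarrow> real" and Z where \<phi>:
    "\<And>i. i \<in> {..d} \<Longrightarrow> continuous_map \<T> euclideanreal (\<phi> i)" "\<And>i x. 0 \<le> \<phi> i x" "\<And>i x. \<phi> i x \<le> 1"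
    "\<And>i. i \<in> {..d} \<Longrightarrow> Z i \<subseteq> O' i" "\<And>i x. i \<in> {..d} \<Longrightarrow> \<phi> i x \<noteq> 0 \<Longrightarrow> x \<in> Z i"
    "\<And>x. x \<in> K0 \<Longrightarrow> \<exists>i\<in>{..d}. \<phi> i x = 1"
    using compact_cover_bumps[OF completely_regular K0, of "{..d}" O'] O' by (metis atMost_iff finite_atMost)
  have colour: "colour G C (U i) (H i) f (\<phi> i) N" if i: "i \<le> d" for i
  proof unfold_locales
    show "\<s> g \<in> U i" if "g \<in> arrows G" "\<phi> i (\<s> g) \<noteq> 0" for g
      using that O'[OF i] \<phi>(4,5)[of i] i by (auto simp: units_def)
    show "g \<in> H i" if "g \<in> short_paths C N \<otimes> C \<otimes> ginv G ` short_paths C N" "\<s> g \<in> U i" "\<r> g \<in> U i" for g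
      using that H[OF i] Kb(4) by (auto simp: R_def)
    show "f k \<noteq> 0 \<Longrightarrow> k \<in> C" for k using f(4) by (auto simp: C_def)
    show "subgroupoid G (H i)" "precompactin \<T> (H i)" using H[OF i] by auto
    show "continuous_map \<T> euclideanreal (\<phi> i)" using \<phi>(1) i by simp
  qed (use C C_sr f \<phi>(2,3) N in auto)
  define \<Psi> where "\<Psi> i = avg C N f (\<lambda>g. \<phi> i (\<s> g))" for i
  have \<Psi>_eq: "colour.\<Psi> G C f (\<phi> i) N = \<Psi> i" if "i \<le> d" for i
    using colour.\<Psi>_def[OF colour[OF that]] by (simp add: \<Psi>_def)
  have \<Psi>_bounds: "0 \<le> \<Psi> i g" "\<Psi> i g \<le> 1" if "i \<le> d" for i g
    using colour.\<Psi>_nonneg[OF colour[OF that]] colour.\<Psi>_le_1[OF colour[OF that]] \<Psi>_eq[OF that] by auto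
  have \<Psi>_cont: "continuous_map \<T> euclideanreal (\<Psi> i)" if "i \<le> d" for i
    using colour.\<Psi>_cont[OF colour[OF that]] \<Psi>_eq[OF that] by auto
  have \<Psi>_src: "\<Psi> i (\<s> g) = \<Psi> i g" if "i \<le> d" "g \<in> arrows G" for i g
    using colour.\<Psi>_src[OF colour] \<Psi>_eq that by auto
  have fK: "f k = 1" "f (k\<^sup>\<star>) = 1" "f (\<s> k) = 1" "f (\<r> k) = 1" if "k \<in> K" for k
    using f(5) that by (auto simp: K1_def)
  have \<Psi>_inv: "\<bar>\<Psi> i (\<r> k) - \<Psi> i (\<s> k)\<bar> \<le> 1 / N" if "i \<le> d" "k \<in> K" for i k
    using colour.\<Psi>_almost_invariant[OF colour[OF that(1)] KA[OF that(2)]] fK[OF that(2)] \<Psi>_eq[OF that(1)]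
    by auto
  define S where "S g = (\<Sum>i\<le>d. \<Psi> i g)" for g
  have \<Psi>_S: "\<Psi> i g \<le> S g" if "i \<le> d" for i g
    unfolding S_def using \<Psi>_bounds that by (intro member_le_sum) auto
  have S_K0: "1 \<le> S x" if "x \<in> K0" for x
  proof -
    obtain i where i: "i \<le> d" "\<phi> i x = 1" using \<phi>(6) \<open>x \<in> K0\<close> by auto
    obtain k where "k \<in> K" "x = \<s> k \<or> x = \<r> k" using \<open>x \<in> K0\<close> by (auto simp: K0_def)
    then have "x \<in> arrows G" "\<s> x = x" "f x = 1" using KA fK by auto
    then have "\<Psi> i x = 1" using colour.\<Psi>_eq_1[OF colour[OF i(1)], of x] i \<Psi>_eq[OF i(1)] by auto
    then show ?thesis using \<Psi>_S[OF i(1), of x] by simp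
  qed
  have S_inv: "\<bar>S (\<r> k) - S (\<s> k)\<bar> \<le> (d + 1) / N" if "k \<in> K" for k
  proof -
    have "\<bar>S (\<r> k) - S (\<s> k)\<bar> \<le> (\<Sum>i\<le>d. \<bar>\<Psi> i (\<r> k) - \<Psi> i (\<s> k)\<bar>)"
      unfolding S_def sum_subtractf[symmetric] by (rule sum_abs)
    also have "\<dots> \<le> (\<Sum>i\<le>d. 1 / N)" using \<Psi>_inv that by (intro sum_mono) auto
    finally show ?thesis by simp
  qed
  \<comment> \<open>Continuous on all arrows thanks to the maximum with 1; on \<open>K0\<close>,
    where \<open>S\<close> is at least 1, the weights sum to exactly 1.\<close>
  define w where "w i g = \<Psi> i g / max 1 (S g)" for i g
  have w_bounds: "0 \<le> w i g" "w i g \<le> \<Psi> i g" if "i \<le> d" for i g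
    using \<Psi>_bounds[OF that, of g] mult_left_mono[of 1 "max 1 (S g)" "\<Psi> i g"]
    by (auto simp: w_def divide_le_eq)
  have w_sum: "(\<Sum>i\<le>d. w i g) = S g / max 1 (S g)" for g
    by (simp add: w_def S_def sum_divide_distrib)
  have w_sum_le: "(\<Sum>i\<le>d. w i g) \<le> 1" for g
    unfolding w_sum by (simp add: divide_le_eq)
  have w_src: "w i (\<s> g) = w i g" if "i \<le> d" "g \<in> arrows G" for i g
    using that by (simp add: w_def S_def \<Psi>_src)
  have w_cont: "continuous_map \<T> euclideanreal (w i)" if "i \<le> d" for i
    unfolding w_def S_def using that \<Psi>_cont by (intro continuous_intros) auto
  have w_inv: "\<bar>w i (\<r> k) - w i (\<s> k)\<bar> \<le> (d + 2) / N" if "i \<le> d" "k \<in> K" for i k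
  proof -
    have 1: "1 \<le> S (\<r> k)" "1 \<le> S (\<s> k)" using S_K0 that by (auto simp: K0_def)
    then have "\<bar>w i (\<r> k) - w i (\<s> k)\<bar> \<le> \<bar>\<Psi> i (\<r> k) - \<Psi> i (\<s> k)\<bar> + \<bar>S (\<r> k) - S (\<s> k)\<bar>"
      using abs_normalised_diff_le[OF 1, of "\<Psi> i (\<s> k)" "\<Psi> i (\<r> k)"] \<Psi>_bounds \<Psi>_S that
      by (simp add: w_def)
    also have "\<dots> \<le> 1 / N + (d + 1) / N" using \<Psi>_inv S_inv that by (intro add_mono) auto
    also have "\<dots> = (d + 2) / N" by (simp add: add_divide_distrib)
    finally show ?thesis .
  qed
  define density where "density i Q P \<longleftrightarrow> compactin \<T> Q \<and> continuous_map \<T> euclideanreal P \<and>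
      (\<forall>g. 0 \<le> P g) \<and> (\<forall>g. P g \<noteq> 0 \<longrightarrow> g \<in> Q) \<and>
      (\<forall>A x. finite A \<longrightarrow> A \<subseteq> source_fibre G x \<longrightarrow> sum P A \<le> 1) \<and>
      (\<forall>A x. finite A \<longrightarrow> A \<subseteq> source_fibre G x \<longrightarrow> Q \<inter> source_fibre G x \<subseteq> A \<longrightarrow> x \<in> units G \<longrightarrow>
         f x = 1 \<longrightarrow> 1 \<le> N * \<Psi> i x \<longrightarrow> sum P A = 1) \<and>
      (\<forall>A k. finite A \<longrightarrow> A \<subseteq> source_fibre G (\<r> k) \<longrightarrow> k \<in> K \<longrightarrow>
         1 \<le> N * \<Psi> i (\<s> k) \<longrightarrow> 1 \<le> N * \<Psi> i (\<r> k) \<longrightarrow> (\<Sum>g\<in>A. \<bar>P g - P (g \<odot> k)\<bar>) \<le> 1 / N)" for i Q and P :: "'a \<Rightarrow> real"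
  have "\<exists>Q P. density i Q P" if "i \<le> d" for i
    unfolding density_def
    by (rule colour.invariant_density[OF colour[OF that]], unfold \<Psi>_eq[OF that], intro exI conjI)
       (use KA fK in \<open>(simp; fail)+\<close>)
  then have "\<forall>i. \<exists>QP. i \<le> d \<longrightarrow> density i (fst QP) (snd QP)" by simp
  from choice[OF this] obtain QP where QP: "\<forall>i. i \<le> d \<longrightarrow> density i (fst (QP i)) (snd (QP i))" ..
  define Q P where "Q i = fst (QP i)" and "P i = snd (QP i)" for i
  have P0: "density i (Q i) (P i)" if "i \<le> d" for i using QP that by (simp add: Q_def P_def)
  note P = P0[unfolded density_def]
  note Q = P[THEN conjunct1]
    and P_cont = P[THEN conjunct2, THEN conjunct1]
    and P_nonneg = P[THEN conjunct2, THEN conjunct2, THEN conjunct1, rule_format]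
    and P_supp = P[THEN conjunct2, THEN conjunct2, THEN conjunct2, THEN conjunct1, rule_format]
    and P_le = P[THEN conjunct2, THEN conjunct2, THEN conjunct2, THEN conjunct2, THEN conjunct1, rule_format]
    and P_eq = P[THEN conjunct2, THEN conjunct2, THEN conjunct2, THEN conjunct2, THEN conjunct2, THEN conjunct1, rule_format]
    and P_inv = P[THEN conjunct2, THEN conjunct2, THEN conjunct2, THEN conjunct2, THEN conjunct2, THEN conjunct2, rule_format]
  define QQ where "QQ = (\<Union>i\<le>d. Q i)"
  have QQ: "compactin \<T> QQ" unfolding QQ_def using Q by (intro compactin_Union) auto
  have fin: "finite (QQ \<inter> source_fibre G x)" for x using fibre_card_bounded[OF QQ] by metis
  define \<mu> where "\<mu> g = (\<Sum>i\<le>d. w i g * P i g)" for g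
  have \<mu>_nonneg: "0 \<le> \<mu> g" for g unfolding \<mu>_def using w_bounds P_nonneg by (intro sum_nonneg) auto
  have \<mu>_supp: "g \<in> QQ" if "\<mu> g \<noteq> 0" for g
  proof -
    obtain i where "i \<le> d" "P i g \<noteq> 0"
      using \<open>\<mu> g \<noteq> 0\<close> unfolding \<mu>_def by (metis (no_types, lifting) atMost_iff mult_zero_right sum.neutral)
    then show ?thesis using P_supp by (auto simp: QQ_def)
  qed
  have \<mu>_sum: "sum \<mu> A = (\<Sum>i\<le>d. w i x * sum (P i) A)" if A: "A \<subseteq> source_fibre G x" for A x
  proof -
    have "sum \<mu> A = (\<Sum>i\<le>d. \<Sum>g\<in>A. w i g * P i g)" unfolding \<mu>_def by (rule sum.swap)
    also have "\<dots> = (\<Sum>i\<le>d. \<Sum>g\<in>A. w i x * P i g)"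
      using A w_src by (intro sum.cong) (auto simp: source_fibre_def)
    finally show ?thesis by (simp add: sum_distrib_left)
  qed
  have \<mu>_sum_le: "sum \<mu> A \<le> 1" if A: "finite A" "A \<subseteq> source_fibre G x" for A x
  proof -
    have "sum \<mu> A \<le> (\<Sum>i\<le>d. w i x)"
      unfolding \<mu>_sum[OF A(2)] using w_bounds P_le[OF _ A] by (intro sum_mono mult_left_le) auto
    then show ?thesis using w_sum_le[of x] by simp
  qed
  have infsum_eq: "(\<Sum>\<^sub>\<infinity>g\<in>source_fibre G x. h g) = sum h A"
    if "finite A" "A \<subseteq> source_fibre G x" "\<And>g. g \<in> source_fibre G x - A \<Longrightarrow> h g = 0"
    for h :: "'a \<Rightarrow> real" and A x
    using infsum_cong_neutral[of A "source_fibre G x" h h] that by auto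
  have \<mu>_infsum: "(\<Sum>\<^sub>\<infinity>g\<in>source_fibre G x. \<mu> g) = sum \<mu> (QQ \<inter> source_fibre G x)" for x
    using fin \<mu>_supp by (intro infsum_eq) auto
  have unit: "\<r> k \<in> units G" if "k \<in> K" for k
    using KA[OF that] unfolding units_def by (metis imageI rng_closed src_rng)
  show "\<exists>\<mu>. continuous_map \<T> (top_of_set {0..1}) \<mu> \<and>
          compactin \<T> (\<T> closure_of {g \<in> arrows G. \<mu> g \<noteq> 0}) \<and>
          (\<forall>x \<in> units G. (\<Sum>\<^sub>\<infinity>g \<in> source_fibre G x. \<mu> g) \<le> 1) \<and>
          (\<forall>k \<in> K. \<bar>1 - (\<Sum>\<^sub>\<infinity>g \<in> source_fibre G (\<r> k). \<mu> g)\<bar> < \<epsilon>) \<and>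
          (\<forall>k \<in> K. (\<Sum>\<^sub>\<infinity>g \<in> source_fibre G (\<r> k). \<bar>\<mu> g - \<mu> (g \<odot> k)\<bar>) < \<epsilon>)"
  proof (intro exI[of _ \<mu>] conjI ballI)
    have "continuous_map \<T> euclideanreal \<mu>"
      unfolding \<mu>_def using P_cont w_cont by (intro continuous_intros) auto
    moreover have "\<mu> g \<le> 1" if "g \<in> arrows G" for g
      using \<mu>_sum_le[of "{g}" "\<s> g"] that by (simp add: source_fibre_def)
    ultimately show "continuous_map \<T> (top_of_set {0..1}) \<mu>"
      using \<mu>_nonneg by (auto simp: continuous_map_in_subtopology)
    have "\<T> closure_of {g \<in> arrows G. \<mu> g \<noteq> 0} \<subseteq> QQ"
      using compact_closed[OF QQ] \<mu>_supp by (intro closure_of_minimal) auto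
    then show "compactin \<T> (\<T> closure_of {g \<in> arrows G. \<mu> g \<noteq> 0})"
      using QQ closed_compactin closedin_closure_of by metis
    show "(\<Sum>\<^sub>\<infinity>g\<in>source_fibre G x. \<mu> g) \<le> 1" for x
      unfolding \<mu>_infsum using fin by (intro \<mu>_sum_le) auto
  next
    fix k assume k: "k \<in> K"
    let ?x = "\<r> k" and ?A = "QQ \<inter> source_fibre G (\<r> k)"
    have x: "?x \<in> K0" using k by (auto simp: K0_def)
    \<comment> \<open>Either \<open>P i\<close> has full mass on this fibre and nothing is lost, or
      the loss is at most \<open>\<Psi> i ?x < 1 / N\<close>.\<close>
    have "w i ?x * (1 - sum (P i) ?A) \<le> 1 / N" if i: "i \<le> d" for i
    proof (cases "1 \<le> N * \<Psi> i ?x")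
      case True
      have "Q i \<inter> source_fibre G ?x \<subseteq> ?A" using i by (auto simp: QQ_def)
      then have "sum (P i) ?A = 1" using True fin fK[OF k] unit[OF k] by (intro P_eq[OF i]) auto
      then show ?thesis by simp
    next
      case False
      have "w i ?x * (1 - sum (P i) ?A) \<le> \<Psi> i ?x * 1"
        using w_bounds[OF i, of ?x] \<Psi>_bounds[OF i, of ?x] P_le[OF i fin, of ?x] P_nonneg[OF i]
        by (intro mult_mono) (auto intro!: sum_nonneg)
      also have "\<dots> \<le> 1 / N" using False N by (simp add: field_simps)
      finally show ?thesis .
    qed
    then have "(\<Sum>i\<le>d. w i ?x * (1 - sum (P i) ?A)) \<le> (\<Sum>i\<le>d. 1 / N)"
      by (intro sum_mono) auto
    moreover have "(\<Sum>i\<le>d. w i ?x) = 1" using w_sum[of ?x] S_K0[OF x] by simp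
    ultimately have "1 - sum \<mu> ?A \<le> (d + 1) / N"
      by (simp add: \<mu>_sum[of ?A ?x] right_diff_distrib sum_subtractf)
    also have "\<dots> \<le> real ((d + 1) * (d + 4)) / N" by (intro divide_right_mono) simp_all
    finally show "\<bar>1 - (\<Sum>\<^sub>\<infinity>g\<in>source_fibre G (\<r> k). \<mu> g)\<bar> < \<epsilon>"
      using \<mu>_sum_le[of ?A ?x] fin N\<epsilon> by (simp add: \<mu>_infsum)
  next
    fix k assume k: "k \<in> K"
    let ?x = "\<r> k" and ?y = "\<s> k"
    note kA = KA[OF k]
    have inj: "inj_on (\<lambda>g. g \<odot> k) (source_fibre G ?x)" and im: "(\<lambda>g. g \<odot> k) ` source_fibre G ?x = source_fibre G ?y"
      using bij_betw_mult_right[OF kA] by (auto simp: bij_betw_def)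
    \<comment> \<open>Every summand off this set vanishes; injectivity of translation by
      \<open>k\<close> makes it finite.\<close>
    define A where "A = {g \<in> source_fibre G ?x. g \<in> QQ \<or> g \<odot> k \<in> QQ}"
    have "finite {g \<in> source_fibre G ?x. g \<odot> k \<in> QQ}"
    proof (rule inj_on_finite)
      show "inj_on (\<lambda>g. g \<odot> k) {g \<in> source_fibre G ?x. g \<odot> k \<in> QQ}"
        using inj by (rule inj_on_subset) auto
      show "(\<lambda>g. g \<odot> k) ` {g \<in> source_fibre G ?x. g \<odot> k \<in> QQ} \<subseteq> QQ \<inter> source_fibre G ?y" using im by auto
    qed (rule fin)
    then have finA: "finite A"
      using fin[of ?x] by (rule_tac finite_subset[of _ "QQ \<inter> source_fibre G ?x \<union> {g \<in> source_fibre G ?x. g \<odot> k \<in> QQ}"]) (auto simp: A_def)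
    have Ax: "A \<subseteq> source_fibre G ?x" by (auto simp: A_def)
    have Pk: "(\<Sum>g\<in>A. P i (g \<odot> k)) \<le> 1" if i: "i \<le> d" for i
    proof -
      have "(\<Sum>g\<in>A. P i (g \<odot> k)) = sum (P i) ((\<lambda>g. g \<odot> k) ` A)"
        using inj_on_subset[OF inj Ax] by (simp add: sum.reindex)
      also have "\<dots> \<le> 1" using finA Ax im by (intro P_le[OF i, of _ ?y]) auto
      finally show ?thesis .
    qed
    \<comment> \<open>If \<open>\<Psi> i\<close> is at least \<open>1 / N\<close> at both ends, the
      weight varies by at most \<open>(d + 2) / N\<close> and the density by \<open>1 / N\<close>.
      Otherwise one value is below \<open>1 / N\<close> and, by near invariance, the other is at
      most \<open>2 / N\<close>, so the crude bound by the sum of both weights suffices.\<close>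
    have main: "(\<Sum>g\<in>A. \<bar>w i ?x * P i g - w i ?y * P i (g \<odot> k)\<bar>) \<le> (d + 3) / N" if i: "i \<le> d" for i
    proof (cases "1 \<le> N * \<Psi> i ?x \<and> 1 \<le> N * \<Psi> i ?y")
      case True
      have "\<bar>w i ?x * P i g - w i ?y * P i (g \<odot> k)\<bar>
          \<le> \<bar>w i ?x - w i ?y\<bar> * P i g + \<bar>P i g - P i (g \<odot> k)\<bar>" for g
      proof -
        have "w i ?x * P i g - w i ?y * P i (g \<odot> k)
            = (w i ?x - w i ?y) * P i g + w i ?y * (P i g - P i (g \<odot> k))" by (simp add: algebra_simps)
        also have "\<bar>\<dots>\<bar> \<le> \<bar>(w i ?x - w i ?y) * P i g\<bar> + \<bar>w i ?y * (P i g - P i (g \<odot> k))\<bar>"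
          by (rule abs_triangle_ineq)
        also have "\<dots> \<le> \<bar>w i ?x - w i ?y\<bar> * P i g + 1 * \<bar>P i g - P i (g \<odot> k)\<bar>"
          using P_nonneg[OF i] w_bounds[OF i, of ?y] \<Psi>_bounds[OF i, of ?y]
          unfolding abs_mult by (intro add_mono mult_right_mono) auto
        finally show ?thesis by simp
      qed
      then have "(\<Sum>g\<in>A. \<bar>w i ?x * P i g - w i ?y * P i (g \<odot> k)\<bar>)
          \<le> (\<Sum>g\<in>A. \<bar>w i ?x - w i ?y\<bar> * P i g + \<bar>P i g - P i (g \<odot> k)\<bar>)" by (rule sum_mono)
      also have "\<dots> = \<bar>w i ?x - w i ?y\<bar> * sum (P i) A + (\<Sum>g\<in>A. \<bar>P i g - P i (g \<odot> k)\<bar>)"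
        by (simp add: sum.distrib sum_distrib_left)
      also have "\<dots> \<le> (d + 2) / N * 1 + 1 / N"
      proof (intro add_mono mult_mono)
        show "(\<Sum>g\<in>A. \<bar>P i g - P i (g \<odot> k)\<bar>) \<le> 1 / N" using finA Ax k True by (intro P_inv[OF i]) auto
      qed (use w_inv[OF i k] P_le[OF i finA Ax] P_nonneg[OF i] in \<open>auto intro: sum_nonneg\<close>)
      also have "\<dots> = (d + 3) / N" by (simp add: add_divide_distrib)
      finally show ?thesis .
    next
      case False
      then have "\<Psi> i ?x < 1 / N \<or> \<Psi> i ?y < 1 / N" using N by (auto simp: field_simps not_le)
      then have le3: "\<Psi> i ?x + \<Psi> i ?y \<le> 3 / N" using \<Psi>_inv[OF i k] by auto
      have "\<bar>w i ?x * P i g - w i ?y * P i (g \<odot> k)\<bar> \<le> w i ?x * P i g + w i ?y * P i (g \<odot> k)" for g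
        using w_bounds(1)[OF i] P_nonneg[OF i] by (simp add: abs_le_iff add_increasing)
      then have "(\<Sum>g\<in>A. \<bar>w i ?x * P i g - w i ?y * P i (g \<odot> k)\<bar>)
          \<le> (\<Sum>g\<in>A. w i ?x * P i g + w i ?y * P i (g \<odot> k))" by (rule sum_mono)
      also have "\<dots> = w i ?x * sum (P i) A + w i ?y * (\<Sum>g\<in>A. P i (g \<odot> k))"
        by (simp add: sum.distrib sum_distrib_left)
      also have "\<dots> \<le> w i ?x * 1 + w i ?y * 1"
        using w_bounds(1)[OF i] P_le[OF i finA Ax] Pk[OF i] by (intro add_mono mult_left_mono) auto
      also have "\<dots> \<le> 3 / N" using w_bounds(2)[OF i, of ?x] w_bounds(2)[OF i, of ?y] le3 by simp
      also have "\<dots> \<le> (d + 3) / N" by (simp add: divide_right_mono)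
      finally show ?thesis .
    qed
    have "(\<Sum>\<^sub>\<infinity>g\<in>source_fibre G ?x. \<bar>\<mu> g - \<mu> (g \<odot> k)\<bar>) = (\<Sum>g\<in>A. \<bar>\<mu> g - \<mu> (g \<odot> k)\<bar>)"
    proof (rule infsum_eq[OF finA Ax])
      fix g assume "g \<in> source_fibre G ?x - A"
      then have "g \<notin> QQ" "g \<odot> k \<notin> QQ" by (auto simp: A_def)
      then have "\<mu> g = 0" "\<mu> (g \<odot> k) = 0" using \<mu>_supp by blast+
      then show "\<bar>\<mu> g - \<mu> (g \<odot> k)\<bar> = 0" by simp
    qed
    also have "\<dots> \<le> (\<Sum>g\<in>A. \<Sum>i\<le>d. \<bar>w i ?x * P i g - w i ?y * P i (g \<odot> k)\<bar>)"
    proof (rule sum_mono)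
      fix g assume "g \<in> A"
      then have g: "g \<in> arrows G" "\<s> g = \<r> k" using Ax by (auto simp: source_fibre_def)
      have "w i g = w i ?x" "w i (g \<odot> k) = w i ?y" if "i \<le> d" for i
        using w_src[OF that, of g] w_src[OF that, of "g \<odot> k"] g kA by auto
      then have "\<mu> g - \<mu> (g \<odot> k) = (\<Sum>i\<le>d. w i ?x * P i g - w i ?y * P i (g \<odot> k))"
        unfolding \<mu>_def sum_subtractf[symmetric] by (intro sum.cong) auto
      then show "\<bar>\<mu> g - \<mu> (g \<odot> k)\<bar> \<le> (\<Sum>i\<le>d. \<bar>w i ?x * P i g - w i ?y * P i (g \<odot> k)\<bar>)"
        by (simp only: sum_abs)
    qed
    also have "\<dots> = (\<Sum>i\<le>d. \<Sum>g\<in>A. \<bar>w i ?x * P i g - w i ?y * P i (g \<odot> k)\<bar>)" by (rule sum.swap)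
    also have "\<dots> \<le> (\<Sum>i\<le>d. (d + 3) / N)" using main by (intro sum_mono) auto
    also have "\<dots> \<le> real ((d + 1) * (d + 4)) / N" by (simp add: divide_right_mono field_simps)
    also note N\<epsilon>
    finally show "(\<Sum>\<^sub>\<infinity>g\<in>source_fibre G (\<r> k). \<bar>\<mu> g - \<mu> (g \<odot> k)\<bar>) < \<epsilon>" .
  qed
qed

end

theorem theorem6p3:
  fixes G :: "'g top_groupoid"
  assumes "etale_groupoid G"
    and "locally_compact_space (arrow_top G)"
    and "Hausdorff_space (arrow_top G)"
    and "finite_dynamic_asymptotic_dimension G"
  shows "amenable G"
proof -
  interpret lch_etale_groupoid G
    using assms by (simp add: lch_etale_groupoid_def lch_etale_groupoid_axioms_def)
  show ?thesis
    using assms(4) dad_cover_property_imp_amenable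
    unfolding finite_dynamic_asymptotic_dimension_def has_dynamic_asymptotic_dimension_def by blast
qed

end
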